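(* Let $n\ge 1$ and let $X=(X_1,\dots,X_n)\sim\mathcal{N}(0,C)$ be a multivariate Gaussian random vector with covariance matrix $C$ such that $C_{ii}=1$ for all $i$. Let $\ell:\mathbb{R}\to\mathbb{R}$ be a continuously differentiable function whose first derivative $\ell'$ is supported on $[-\frac12,\frac12]$. Define $$\widehat{Q}_n(t)=\frac1n\sum_{i=1}^n\ell(t-\Phi(X_i)),\qquad t\in\mathbb{R}.$$ Then $$\mathbf{E}\sup_{t\in\mathbb{R}}\left|\widehat{Q}_n(t)-\mathbf{E}\widehat{Q}_n(t)\right|\le(\sqrt6+\sqrt3)\,D(\ell)\sqrt{\frac{n+\Delta}{n^2}},$$ where $\Delta=\sum_{i\ne j}|C_{ij}|$ (sum over ordered pairs $(i,j)$ with $1\le i,j\le n$, $i\neq j$) and $$D(\ell)=\sqrt{\int_{-1}^2\left[\int_0^1(\ell'(t-y))^2\,dy-\left(\int_0^1\ell'(t-y)\,dy\right)^2\right]dt}.$$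
   Context: $\Phi$ is the cumulative distribution function of the standard Gaussian $\mathcal{N}(0,1)$. The covariance matrix $C$ is otherwise arbitrary (possibly singular). *)

theory Defs
  imports "HOL-Probability.Probability"
begin

text \<open>
  The normal distribution with mean \<open>\<mu>\<close> and standard deviation \<open>\<sigma> \<ge> 0\<close>. The case \<open>\<sigma> = 0\<close> is
  the point mass at \<open>\<mu>\<close>; it has no density, but it occurs for linear combinations of the
  coordinates of a Gaussian vector with singular covariance matrix.
\<close>

definition normal_distr :: "real \<Rightarrow> real \<Rightarrow> real measure" where
  "normal_distr \<mu> \<sigma> =
     (if \<sigma> = 0 then return borel \<mu> else density lborel (\<lambda>x. ennreal (normal_density \<mu> \<sigma> x)))"

definition jointly_gaussian :: "'a measure \<Rightarrow> 'i set \<Rightarrow> ('i \<Rightarrow> 'a \<Rightarrow> real) \<Rightarrow> bool" where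
  "jointly_gaussian M I X \<longleftrightarrow>
     (\<forall>i\<in>I. X i \<in> borel_measurable M) \<and>
     (\<forall>a. \<exists>\<mu> \<sigma>. 0 \<le> \<sigma> \<and> distr M borel (\<lambda>\<omega>. \<Sum>i\<in>I. a i * X i \<omega>) = normal_distr \<mu> \<sigma>)"

text \<open>
  Mean vector \<open>m\<close> and covariance matrix \<open>C\<close>; only the entries with indices in \<open>I\<close> matter.
  Coordinates of a jointly Gaussian family are square-integrable, so the integrals
  below are genuine moments. Symmetry and positive semidefiniteness of \<open>C\<close> are consequences.
\<close>

definition multivariate_normal ::
    "'a measure \<Rightarrow> 'i set \<Rightarrow> ('i \<Rightarrow> 'a \<Rightarrow> real) \<Rightarrow> ('i \<Rightarrow> real) \<Rightarrow> ('i \<Rightarrow> 'i \<Rightarrow> real) \<Rightarrow> bool" where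
  "multivariate_normal M I X m C \<longleftrightarrow>
     jointly_gaussian M I X \<and>
     (\<forall>i\<in>I. integral\<^sup>L M (X i) = m i) \<and>
     (\<forall>i\<in>I. \<forall>j\<in>I. (\<integral>\<omega>. (X i \<omega> - m i) * (X j \<omega> - m j) \<partial>M) = C i j)"

definition Phi :: "real \<Rightarrow> real" where
  "Phi = cdf std_normal_distribution"

definition Q_hat :: "(real \<Rightarrow> real) \<Rightarrow> nat \<Rightarrow> (nat \<Rightarrow> 'a \<Rightarrow> real) \<Rightarrow> real \<Rightarrow> 'a \<Rightarrow> real" where
  "Q_hat l n X t \<omega> = (1 / real n) * (\<Sum>i\<in>{1..n}. l (t - Phi (X i \<omega>)))"

definition D :: "(real \<Rightarrow> real) \<Rightarrow> real" where
  "D l = sqrt (LINT t:{-1..2}|lborel.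
     ((LINT y:{0..1}|lborel. (deriv l (t - y))\<^sup>2) - (LINT y:{0..1}|lborel. deriv l (t - y))\<^sup>2))"

end

theory Submission
  imports Defs
begin

text \<open>
  Put \<open>U\<^sub>i = Phi (X\<^sub>i)\<close>; each \<open>U\<^sub>i\<close> is uniform on \<open>[0,1]\<close>. Since \<open>l'\<close> vanishes outside
  \<open>[-1/2,1/2]\<close>, the function \<open>l\<close> is constant on each side of that interval, so every
  \<open>l (t - U\<^sub>i)\<close> equals \<open>l (-1)\<close> plus the integral of \<open>s \<mapsto> l' (s - U\<^sub>i)\<close> over the part of
  \<open>[-1,2]\<close> to the left of \<open>t\<close>. Hence, with \<open>A s\<close> the average of the \<open>l' (s - U\<^sub>i)\<close>, the deviation
  of the empirical average from its mean is, for every \<open>t\<close> at once, at most the integral of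
  \<open>\<bar>A s - E (A s)\<bar>\<close> over \<open>[-1,2]\<close>. By Fubini the expected supremum is therefore at most the
  integral of the standard deviation of \<open>A s\<close> (\<open>expectation_sup_integral_le\<close>).

  The variance of \<open>A s\<close> is a double sum of covariances of \<open>f (X\<^sub>i)\<close> and \<open>f (X\<^sub>j)\<close> for one centred
  bounded function \<open>f\<close>. For standard normals \<open>X, Y\<close> with correlation \<open>\<rho>\<close> such a covariance is at
  most \<open>2 \<bar>\<rho>\<bar> E f(X)\<^sup>2\<close> (\<open>bivariate_normal_covariance_bound\<close>), a form of Gebelein's inequality
  with a cruder constant. If \<open>\<bar>\<rho>\<bar> > 1/2\<close>, this is the Cauchy--Schwarz inequality. Otherwise write
  \<open>Y = \<rho> X + s Z\<close> with \<open>s\<^sup>2 = 1 - \<rho>\<^sup>2\<close>; then \<open>X\<close> and \<open>Z\<close> are independent standard normals, and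
  \<open>r(x,y)\<close>, the density of \<open>Y\<close> given \<open>X = x\<close> relative to the standard normal law, satisfies
  \<open>E (r - 1)\<^sup>2 = 1/s\<^sup>2 - 1 = \<rho>\<^sup>2/s\<^sup>2\<close> for independent standard normal arguments. As \<open>f\<close> is centred,
  the covariance is the integral of \<open>f(x) f(y) (r(x,y) - 1)\<close>, and Cauchy--Schwarz bounds it by
  \<open>\<bar>\<rho>\<bar>/s E f(X)\<^sup>2\<close>, where \<open>1/s \<le> 2\<close>.

  Joint Gaussianity is given through the laws of linear combinations, that is, through the joint
  characteristic function. The independence of \<open>X\<close> and \<open>Z\<close> is read off from its factorization
  (\<open>indep_var_if_iexp_factors\<close>).

  Altogether the variance of \<open>A s\<close> is at most \<open>2 (n + \<Delta>)/n\<^sup>2\<close> times the variance of \<open>l' (s - U)\<close>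
  for a uniform \<open>U\<close>. A last Cauchy--Schwarz inequality over \<open>[-1,2]\<close>, an interval of length 3,
  turns the integral of the square root of the latter into \<open>sqrt 3 * D l\<close>, which gives the
  bound with the factor \<open>sqrt 2 * sqrt 3 = sqrt 6\<close>.
\<close>

section \<open>Integral inequalities\<close>

lemma Cauchy_Schwarz_integral:
  fixes f g :: "'a \<Rightarrow> real"
  assumes [measurable]: "f \<in> borel_measurable M" "g \<in> borel_measurable M"
    and f2: "integrable M (\<lambda>x. (f x)\<^sup>2)" and g2: "integrable M (\<lambda>x. (g x)\<^sup>2)"
  shows "integrable M (\<lambda>x. f x * g x)"
    and "(\<integral>x. f x * g x \<partial>M)\<^sup>2 \<le> (\<integral>x. (f x)\<^sup>2 \<partial>M) * (\<integral>x. (g x)\<^sup>2 \<partial>M)"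
proof -
  have bound: "\<bar>a * b\<bar> \<le> a\<^sup>2 + b\<^sup>2" for a b :: real
    using sum_squares_bound[of a b] sum_squares_bound[of a "-b"] by (auto simp: abs_if)
  show fg: "integrable M (\<lambda>x. f x * g x)"
    by (rule Bochner_Integration.integrable_bound[OF Bochner_Integration.integrable_add[OF f2 g2]])
      (auto intro!: AE_I2 order_trans[OF bound])
  define A where "A = (\<integral>x. (f x)\<^sup>2 \<partial>M)"
  define B where "B = (\<integral>x. f x * g x \<partial>M)"
  define C where "C = (\<integral>x. (g x)\<^sup>2 \<partial>M)"
  have quad: "0 \<le> s\<^sup>2 * A + 2 * s * t * B + t\<^sup>2 * C" for s t
  proof -
    have "0 \<le> (\<integral>x. (s * f x + t * g x)\<^sup>2 \<partial>M)"
      by simp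
    also have "\<dots> = (\<integral>x. s\<^sup>2 * (f x)\<^sup>2 + 2 * s * t * (f x * g x) + t\<^sup>2 * (g x)\<^sup>2 \<partial>M)"
      by (intro Bochner_Integration.integral_cong refl) (simp add: power2_eq_square algebra_simps)
    also have "\<dots> = s\<^sup>2 * A + 2 * s * t * B + t\<^sup>2 * C"
      using f2 g2 fg by (simp add: A_def B_def C_def)
    finally show ?thesis .
  qed
  have "B\<^sup>2 \<le> A * C"
  proof (cases "C = 0")
    case True
    have "B = 0"
    proof (rule ccontr)
      assume "B \<noteq> 0"
      then show False
        (* for C = 0 the quadratic form takes the value -1 at this point *)
        using quad[of 1 "- (A + 1) / (2 * B)"] True by (simp add: field_simps)
    qed
    then show ?thesis using True by simp
  next
    case False
    then have "C > 0"
      unfolding C_def by (simp add: order_less_le)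
    moreover have "0 \<le> C * (A * C - B\<^sup>2)"
      using quad[of C "-B"] by (simp add: power2_eq_square algebra_simps)
    ultimately show ?thesis
      by (simp add: zero_le_mult_iff)
  qed
  then show "(\<integral>x. f x * g x \<partial>M)\<^sup>2 \<le> (\<integral>x. (f x)\<^sup>2 \<partial>M) * (\<integral>x. (g x)\<^sup>2 \<partial>M)"
    by (simp add: A_def B_def C_def)
qed

lemma (in prob_space) integrable_if_bounded:
  fixes f :: "'a \<Rightarrow> real"
  assumes [measurable]: "f \<in> borel_measurable M" and bound: "\<And>x. \<bar>f x\<bar> \<le> c"
  shows "integrable M f" "integrable M (\<lambda>x. (f x)\<^sup>2)"
proof -
  show "integrable M f"
    by (rule integrable_const_bound[of _ c]) (simp_all add: bound)
  have "(f x)\<^sup>2 \<le> c\<^sup>2" for x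
    using power_mono[OF bound[of x], of 2] by simp
  then show "integrable M (\<lambda>x. (f x)\<^sup>2)"
    by (intro integrable_const_bound[of _ "c\<^sup>2"]) simp_all
qed

lemma (in prob_space) expectation_abs_le_sqrt:
  fixes f :: "'a \<Rightarrow> real"
  assumes [measurable]: "f \<in> borel_measurable M" and "integrable M (\<lambda>x. (f x)\<^sup>2)"
  shows "expectation (\<lambda>x. \<bar>f x\<bar>) \<le> sqrt (expectation (\<lambda>x. (f x)\<^sup>2))"
  using Cauchy_Schwarz_integral(2)[of "\<lambda>x. \<bar>f x\<bar>" M "\<lambda>_. 1"] assms
  by (simp add: prob_space real_le_rsqrt)

section \<open>Independence from characteristic functions\<close>

text \<open>
  The one-dimensional uniqueness theorem for characteristic functions, applied after the change
  of measure with density \<open>W / E W\<close>: the hypothesis says that this change of measure does not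
  affect the characteristic function of \<open>X\<close>, hence it does not affect the law of \<open>X\<close>.
\<close>

lemma (in prob_space) indicator_mult_weight_eq:
  fixes X W :: "'a \<Rightarrow> real"
  assumes [measurable]: "X \<in> borel_measurable M" "W \<in> borel_measurable M"
    and W: "\<And>\<omega>. 0 \<le> W \<omega>" "\<And>\<omega>. W \<omega> \<le> c"
    and char: "\<And>s. expectation (\<lambda>\<omega>. iexp (s * X \<omega>) * complex_of_real (W \<omega>)) =
        expectation (\<lambda>\<omega>. iexp (s * X \<omega>)) * complex_of_real (expectation W)"
    and A[measurable]: "A \<in> sets borel"
  shows "expectation (\<lambda>\<omega>. indicator A (X \<omega>) * W \<omega>) = prob (X -` A \<inter> space M) * expectation W"
proof -
  have intW: "integrable M W"
    by (rule integrable_const_bound[of _ c]) (use W in auto)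
  show ?thesis
  proof (cases "expectation W = 0")
    case True
    then have "AE \<omega> in M. W \<omega> = 0"
      using intW W by (subst (asm) integral_nonneg_eq_0_iff_AE) auto
    then have "expectation (\<lambda>\<omega>. indicator A (X \<omega>) * W \<omega>) = expectation (\<lambda>_. 0)"
      by (intro integral_cong_AE) auto
    then show ?thesis using True by simp
  next
    case False
    define w where "w = expectation W"
    have w: "w > 0"
      using False W Bochner_Integration.integral_nonneg[of M W] by (simp add: w_def order_less_le)
    define N where "N = density M (\<lambda>\<omega>. ennreal (W \<omega> / w))"
    have intN: "integral\<^sup>L N g = (\<integral>\<omega>. (W \<omega> / w) *\<^sub>R g \<omega> \<partial>M)" if "g \<in> borel_measurable M"
      for g :: "'a \<Rightarrow> 'b::{banach, second_countable_topology}"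
      unfolding N_def using that W w by (subst integral_density) auto
    have [measurable_cong]: "sets N = sets M" by (simp add: N_def)
    interpret N: prob_space N
    proof
      have "emeasure N (space N) = (\<integral>\<^sup>+ \<omega>. ennreal (W \<omega> / w) \<partial>M)"
        by (simp add: N_def emeasure_density cong: nn_integral_cong)
      also have "\<dots> = ennreal (\<integral>\<omega>. W \<omega> / w \<partial>M)"
        using W w intW by (intro nn_integral_eq_integral) auto
      also have "\<dots> = 1" using w by (simp add: w_def[symmetric])
      finally show "emeasure N (space N) = 1" .
    qed
    have [measurable]: "X \<in> borel_measurable N" by simp
    have "distr N borel X = distr M borel X"
    proof (rule Levy_uniqueness)
      show "real_distribution (distr N borel X)" by (rule N.real_distribution_distr) simp
      show "real_distribution (distr M borel X)" by (rule real_distribution_distr) simp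
      show "char (distr N borel X) = char (distr M borel X)"
      proof
        fix s
        have "char (distr N borel X) s = (\<integral>\<omega>. iexp (s * X \<omega>) \<partial>N)"
          by (simp add: char_def integral_distr)
        also have "\<dots> = (\<integral>\<omega>. (iexp (s * X \<omega>) * complex_of_real (W \<omega>)) / complex_of_real w \<partial>M)"
          by (subst intN) (auto intro!: Bochner_Integration.integral_cong simp: scaleR_conv_of_real field_simps)
        also have "\<dots> = (\<integral>\<omega>. iexp (s * X \<omega>) * complex_of_real (W \<omega>) \<partial>M) / complex_of_real w"
          by (rule integral_divide_zero)
        also have "\<dots> = expectation (\<lambda>\<omega>. iexp (s * X \<omega>))"
          unfolding char using w by (simp add: w_def[symmetric])
        also have "\<dots> = char (distr M borel X) s"
          by (simp add: char_def integral_distr)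
        finally show "char (distr N borel X) s = char (distr M borel X) s" .
      qed
    qed
    then have "measure (distr N borel X) A = measure (distr M borel X) A" by simp
    then have "measure N (X -` A \<inter> space M) = prob (X -` A \<inter> space M)"
      by (simp add: measure_distr N_def)
    moreover have "measure N (X -` A \<inter> space M) = (\<integral>\<omega>. indicator (X -` A \<inter> space M) \<omega> \<partial>N)"
      by (simp add: N_def)
    moreover have "\<dots> = (\<integral>\<omega>. (W \<omega> / w) * indicator A (X \<omega>) \<partial>M)"
      by (subst intN) (auto intro!: Bochner_Integration.integral_cong simp: indicator_def)
    moreover have "\<dots> = (\<integral>\<omega>. indicator A (X \<omega>) * W \<omega> \<partial>M) / w"
      by (simp add: mult.commute)
    ultimately show ?thesis using w by (simp add: w_def field_simps)
  qed
qed

lemma (in prob_space) integrable_iexp: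
  fixes X :: "'a \<Rightarrow> real"
  assumes [measurable]: "X \<in> borel_measurable M"
  shows "integrable M (\<lambda>\<omega>. iexp (X \<omega>))"
  by (rule integrable_const_bound[of _ 1]) auto

text \<open>
  Only weights with nonnegative real values can serve as densities, so \<open>iexp (t * Y)\<close> enters through
  the weights \<open>1 + cos (t * Y + b)\<close>, where \<open>b = 0\<close> and \<open>b = - pi / 2\<close> give its real and imaginary
  parts. This makes events of \<open>X\<close> independent of \<open>iexp (t * Y)\<close> for each \<open>t\<close>; taking then the
  indicator of such an event as a weight makes them independent of events of \<open>Y\<close>.
\<close>

lemma (in prob_space) indep_var_if_iexp_factors:
  fixes X Y :: "'a \<Rightarrow> real"
  assumes [measurable]: "X \<in> borel_measurable M" "Y \<in> borel_measurable M"
    and char: "\<And>s t. expectation (\<lambda>\<omega>. iexp (s * X \<omega> + t * Y \<omega>)) =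
        expectation (\<lambda>\<omega>. iexp (s * X \<omega>)) * expectation (\<lambda>\<omega>. iexp (t * Y \<omega>))"
  shows "indep_var borel X borel Y"
proof -
  define E where "E s t = expectation (\<lambda>\<omega>. iexp (s * X \<omega> + t * Y \<omega>))" for s t
  have EX: "expectation (\<lambda>\<omega>. iexp (s * X \<omega>)) = E s 0" for s
    by (simp add: E_def)
  have EY: "expectation (\<lambda>\<omega>. iexp (t * Y \<omega>)) = E 0 t" for t
    by (simp add: E_def)
  have E_mult: "E s t = E s 0 * E 0 t" for s t
    using char[of s t] unfolding EX EY by (simp add: E_def)
  have intE: "integrable M (\<lambda>\<omega>. iexp (s * X \<omega> + t * Y \<omega>))" for s t
    by (rule integrable_iexp) simp
  have icos: "integrable M (\<lambda>\<omega>. cos (t * Y \<omega> + b))" for t b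
    by (rule integrable_const_bound[of _ 1]) auto
  have cos_eq: "iexp (s * x) * complex_of_real (cos (t * y + b)) =
      (iexp b * iexp (s * x + t * y) + iexp (- b) * iexp (s * x + (- t) * y)) / 2" for s t x y b :: real
  proof -
    have "complex_of_real (cos r) = (iexp r + iexp (- r)) / 2" for r :: real
      using cos_exp_eq[of "complex_of_real r"] by (simp add: cos_of_real)
    then show ?thesis
      by (simp only:) (simp add: exp_add[symmetric] algebra_simps)
  qed
  have E_cos: "expectation (\<lambda>\<omega>. iexp (s * X \<omega>) * complex_of_real (cos (t * Y \<omega> + b))) =
      (iexp b * E s t + iexp (- b) * E s (- t)) / 2" for s t b
    unfolding cos_eq E_def
    by (subst integral_divide_zero, subst Bochner_Integration.integral_add)
      (use intE in \<open>simp_all only: integral_mult_right_zero integrable_mult_right\<close>)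
  have E_cos_mult: "expectation (\<lambda>\<omega>. iexp (s * X \<omega>) * complex_of_real (cos (t * Y \<omega> + b))) =
      E s 0 * complex_of_real (expectation (\<lambda>\<omega>. cos (t * Y \<omega> + b)))" for s t b
  proof -
    have "complex_of_real (expectation (\<lambda>\<omega>. cos (t * Y \<omega> + b))) =
        (iexp b * E 0 t + iexp (- b) * E 0 (- t)) / 2"
      using E_cos[of 0 t b] by simp
    then show ?thesis
      unfolding E_cos E_mult[of s t] E_mult[of s "-t"] by (simp add: algebra_simps)
  qed
  have expectation_indicator: "expectation (\<lambda>\<omega>. indicator A (X \<omega>)) = prob (X -` A \<inter> space M)"
    if [measurable]: "A \<in> sets borel" for A
    by (subst Bochner_Integration.integral_cong[OF refl, of _ _ "indicator (X -` A \<inter> space M)"])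
      (auto simp: indicator_def)
  have ind_cos: "expectation (\<lambda>\<omega>. indicator A (X \<omega>) * cos (t * Y \<omega> + b)) =
      prob (X -` A \<inter> space M) * expectation (\<lambda>\<omega>. cos (t * Y \<omega> + b))"
    if [measurable]: "A \<in> sets borel" for A t b
  proof -
    have "expectation (\<lambda>\<omega>. indicator A (X \<omega>) * (1 + cos (t * Y \<omega> + b))) =
        prob (X -` A \<inter> space M) * expectation (\<lambda>\<omega>. 1 + cos (t * Y \<omega> + b))"
    proof (rule indicator_mult_weight_eq[where c=2])
      fix s
      have "expectation (\<lambda>\<omega>. iexp (s * X \<omega>) * complex_of_real (1 + cos (t * Y \<omega> + b))) =
        expectation (\<lambda>\<omega>. iexp (s * X \<omega>) + iexp (s * X \<omega>) * complex_of_real (cos (t * Y \<omega> + b)))"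
        by (simp add: algebra_simps)
      also have "\<dots> = expectation (\<lambda>\<omega>. iexp (s * X \<omega>)) +
          expectation (\<lambda>\<omega>. iexp (s * X \<omega>) * complex_of_real (cos (t * Y \<omega> + b)))"
        by (intro Bochner_Integration.integral_add integrable_const_bound[of _ 1])
          (auto simp: norm_mult)
      also have "\<dots> = expectation (\<lambda>\<omega>. iexp (s * X \<omega>)) *
          complex_of_real (expectation (\<lambda>\<omega>. 1 + cos (t * Y \<omega> + b)))"
        unfolding E_cos_mult EX using icos[of t b] by (simp add: prob_space algebra_simps)
      finally show "expectation (\<lambda>\<omega>. iexp (s * X \<omega>) * complex_of_real (1 + cos (t * Y \<omega> + b))) = \<dots>" .
    next
      show "0 \<le> 1 + cos (t * Y \<omega> + b)" for \<omega> using cos_ge_minus_one[of "t * Y \<omega> + b"] by linarith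
    qed auto
    moreover have "expectation (\<lambda>\<omega>. indicator A (X \<omega>) * (1 + cos (t * Y \<omega> + b))) =
      expectation (\<lambda>\<omega>. indicator A (X \<omega>)) + expectation (\<lambda>\<omega>. indicator A (X \<omega>) * cos (t * Y \<omega> + b))"
      unfolding distrib_left mult_1_right
      by (intro Bochner_Integration.integral_add integrable_const_bound[of _ 1])
        (auto simp: indicator_def)
    ultimately show ?thesis
      using icos[of t b] by (simp add: expectation_indicator prob_space algebra_simps)
  qed
  have iexp_eq: "iexp r = complex_of_real (cos (r + 0)) + \<i> * complex_of_real (cos (r + - (pi / 2)))" for r
    by (simp add: exp_Euler cos_diff cos_of_real sin_of_real)
  have ind_iexp: "expectation (\<lambda>\<omega>. iexp (t * Y \<omega>) * complex_of_real (indicator A (X \<omega>))) =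
      expectation (\<lambda>\<omega>. iexp (t * Y \<omega>)) * complex_of_real (expectation (\<lambda>\<omega>. indicator A (X \<omega>)))"
    if [measurable]: "A \<in> sets borel" for A t
  proof -
    have "expectation (\<lambda>\<omega>. iexp (t * Y \<omega>) * complex_of_real (indicator A (X \<omega>))) =
      expectation (\<lambda>\<omega>. complex_of_real (indicator A (X \<omega>) * cos (t * Y \<omega> + 0)) +
        \<i> * complex_of_real (indicator A (X \<omega>) * cos (t * Y \<omega> + - (pi / 2))))"
      unfolding iexp_eq by (simp add: algebra_simps)
    also have "\<dots> = complex_of_real (expectation (\<lambda>\<omega>. indicator A (X \<omega>) * cos (t * Y \<omega> + 0))) +
        \<i> * complex_of_real (expectation (\<lambda>\<omega>. indicator A (X \<omega>) * cos (t * Y \<omega> + - (pi / 2))))"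
      unfolding integral_complex_of_real[symmetric] integral_mult_right_zero[symmetric]
      by (intro Bochner_Integration.integral_add integrable_const_bound[of _ 1])
        (auto simp: indicator_def norm_mult)
    also have "\<dots> = complex_of_real (prob (X -` A \<inter> space M)) *
       (complex_of_real (expectation (\<lambda>\<omega>. cos (t * Y \<omega> + 0))) +
        \<i> * complex_of_real (expectation (\<lambda>\<omega>. cos (t * Y \<omega> + - (pi / 2)))))"
      unfolding ind_cos[OF that] by (simp add: algebra_simps)
    also have "complex_of_real (expectation (\<lambda>\<omega>. cos (t * Y \<omega> + 0))) +
        \<i> * complex_of_real (expectation (\<lambda>\<omega>. cos (t * Y \<omega> + - (pi / 2)))) =
        expectation (\<lambda>\<omega>. complex_of_real (cos (t * Y \<omega> + 0)) +
          \<i> * complex_of_real (cos (t * Y \<omega> + - (pi / 2))))"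
      unfolding integral_complex_of_real[symmetric] integral_mult_right_zero[symmetric]
      by (intro Bochner_Integration.integral_add[symmetric] integrable_const_bound[of _ 1])
        (auto simp: norm_mult)
    also have "\<dots> = expectation (\<lambda>\<omega>. iexp (t * Y \<omega>))"
      unfolding iexp_eq ..
    finally show ?thesis
      by (simp add: expectation_indicator mult.commute)
  qed
  have "prob (X -` A \<inter> space M \<inter> (Y -` B \<inter> space M)) = prob (X -` A \<inter> space M) * prob (Y -` B \<inter> space M)"
    if [measurable]: "A \<in> sets borel" "B \<in> sets borel" for A B
  proof -
    have "expectation (\<lambda>\<omega>. indicator B (Y \<omega>) * indicator A (X \<omega>)) =
        prob (Y -` B \<inter> space M) * expectation (\<lambda>\<omega>. indicator A (X \<omega>))"
    proof (rule indicator_mult_weight_eq[where c=1])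
      show "indicator A (X \<omega>) \<le> (1 :: real)" for \<omega>
        by (rule indicator_le_1)
    qed (use ind_iexp in simp_all)
    moreover have "expectation (\<lambda>\<omega>. indicator B (Y \<omega>) * indicator A (X \<omega>)) =
        prob (X -` A \<inter> space M \<inter> (Y -` B \<inter> space M))"
      by (subst Bochner_Integration.integral_cong[OF refl, of _ _
            "indicator (X -` A \<inter> space M \<inter> (Y -` B \<inter> space M))"])
        (auto simp: indicator_def)
    ultimately show ?thesis by (simp add: expectation_indicator)
  qed
  then have "indep_set {X -` A \<inter> space M |A. A \<in> sets borel} {Y -` B \<inter> space M |B. B \<in> sets borel}"
    by (intro indep_setI) auto
  moreover have "Int_stable {Z -` A \<inter> space M |A. A \<in> sets borel}" for Z :: "'a \<Rightarrow> real"
  proof (safe intro!: Int_stableI)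
    fix A B :: "real set" assume "A \<in> sets borel" "B \<in> sets borel"
    then show "\<exists>C. Z -` A \<inter> space M \<inter> (Z -` B \<inter> space M) = Z -` C \<inter> space M \<and> C \<in> sets borel"
      by (intro exI[of _ "A \<inter> B"]) auto
  qed
  ultimately show ?thesis
    unfolding indep_var_eq by (intro conjI indep_set_sigma_sets) simp_all
qed

section \<open>Correlated standard normals\<close>

abbreviation N01 :: "real measure" where
  "N01 \<equiv> std_normal_distribution"

lemma measure_N01_UNIV: "measure N01 UNIV = 1"
proof -
  interpret N: prob_space N01 by (rule prob_space_normal_density) simp
  show ?thesis using N.prob_space by simp
qed

lemma integral_N01:
  fixes f :: "real \<Rightarrow> real"
  assumes [measurable]: "f \<in> borel_measurable borel"
  shows "(\<integral>x. f x \<partial>N01) = (\<integral>x. std_normal_density x * f x \<partial>lborel)"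
    and "integrable N01 f \<longleftrightarrow> integrable lborel (\<lambda>x. std_normal_density x * f x)"
  by (auto simp: integral_density integrable_density)

text \<open>
  For standard normals \<open>X, Y\<close> with correlation \<open>\<rho>\<close>, this is the conditional density of \<open>Y\<close>
  given \<open>X = x\<close> relative to the standard normal law (the Mehler kernel).
\<close>

definition gauss_ratio :: "real \<Rightarrow> real \<Rightarrow> real \<Rightarrow> real" where
  "gauss_ratio \<rho> x y = normal_density (\<rho> * x) (sqrt (1 - \<rho>\<^sup>2)) y / std_normal_density y"

lemma gauss_ratio_measurable[measurable]:
  "(\<lambda>y. gauss_ratio \<rho> x y) \<in> borel_measurable borel"
  unfolding gauss_ratio_def by measurable

lemma gauss_ratio_affine:
  fixes f :: "real \<Rightarrow> real"
  assumes \<rho>: "\<bar>\<rho>\<bar> < 1" and [measurable]: "f \<in> borel_measurable borel"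
  shows "(\<integral>z. f (\<rho> * x + sqrt (1 - \<rho>\<^sup>2) * z) \<partial>N01) = (\<integral>y. gauss_ratio \<rho> x y * f y \<partial>N01)"
proof -
  define s where "s = sqrt (1 - \<rho>\<^sup>2)"
  have s: "s > 0" using \<rho> by (simp add: s_def abs_square_less_1)
  interpret N: prob_space N01 by (rule prob_space_normal_density) simp
  have "distributed N01 lborel (\<lambda>z. z) std_normal_density"
    by (auto simp: distributed_def distr_id2)
  from N.normal_density_affine[OF this, of s "\<rho> * x"] s
  have d: "distributed N01 lborel (\<lambda>z. \<rho> * x + s * z) (normal_density (\<rho> * x) s)"
    by simp
  have "(\<integral>z. f (\<rho> * x + s * z) \<partial>N01) = (\<integral>y. normal_density (\<rho> * x) s y * f y \<partial>lborel)"
    by (rule distributed_integral[OF d, symmetric]) auto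
  also have "\<dots> = (\<integral>y. gauss_ratio \<rho> x y * f y \<partial>N01)"
    using normal_density_pos[of 1 0]
    by (subst integral_N01(1)) (auto intro!: Bochner_Integration.integral_cong
        simp: gauss_ratio_def s_def[symmetric] less_imp_neq[symmetric])
  finally show ?thesis by (simp add: s_def)
qed

text \<open>
  Completing the square in the exponent shows that the squared kernel times the normal density is
  again a multiple of a normal density in \<open>y\<close>, with mean \<open>2 \<rho> x / q\<close> and variance \<open>(1 - \<rho>\<^sup>2) / q\<close>
  for \<open>q = 1 + \<rho>\<^sup>2\<close>.
\<close>

lemma gauss_ratio_L2:
  assumes \<rho>: "\<bar>\<rho>\<bar> < 1"
  shows "integrable N01 (\<lambda>y. (gauss_ratio \<rho> x y)\<^sup>2)" (is ?I)
    and "(\<integral>y. (gauss_ratio \<rho> x y)\<^sup>2 \<partial>N01) =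
      exp (\<rho>\<^sup>2 * x\<^sup>2 / (1 + \<rho>\<^sup>2)) / (sqrt (1 - \<rho>\<^sup>2) * sqrt (1 + \<rho>\<^sup>2))" (is ?E)
proof -
  define s where "s = sqrt (1 - \<rho>\<^sup>2)"
  define q where "q = 1 + \<rho>\<^sup>2"
  define c where "c = exp (\<rho>\<^sup>2 * x\<^sup>2 / q) / (s * sqrt q)"
  have s: "s > 0" using \<rho> by (simp add: s_def abs_square_less_1)
  have s2: "s\<^sup>2 = 1 - \<rho>\<^sup>2" using \<rho> by (simp add: s_def abs_square_less_1 less_imp_le)
  have q: "q > 0" by (simp add: q_def add_pos_nonneg)
  have eq: "std_normal_density y * (gauss_ratio \<rho> x y)\<^sup>2 =
      c * normal_density (2 * \<rho> * x / q) (s / sqrt q) y" for y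
  proof -
    have expo: "- (y - \<rho> * x)\<^sup>2 / (2 * s\<^sup>2) + - (y - \<rho> * x)\<^sup>2 / (2 * s\<^sup>2) - - y\<^sup>2 / 2 =
        \<rho>\<^sup>2 * x\<^sup>2 / q + - (y - 2 * \<rho> * x / q)\<^sup>2 / (2 * (s / sqrt q)\<^sup>2)"
    proof -
      have "2 * s\<^sup>2 * q * (- (y - \<rho> * x)\<^sup>2 / (2 * s\<^sup>2) + - (y - \<rho> * x)\<^sup>2 / (2 * s\<^sup>2) - - y\<^sup>2 / 2) =
        q * (s\<^sup>2 * y\<^sup>2 - 2 * (y - \<rho> * x)\<^sup>2)"
        using s by (simp add: field_simps)
      also have "\<dots> = 2 * s\<^sup>2 * (\<rho>\<^sup>2 * x\<^sup>2) - (q * y - 2 * \<rho> * x)\<^sup>2"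
        unfolding s2 q_def by (simp add: power2_eq_square algebra_simps)
      also have "\<dots> = 2 * s\<^sup>2 * q * (\<rho>\<^sup>2 * x\<^sup>2 / q + - (y - 2 * \<rho> * x / q)\<^sup>2 / (2 * (s / sqrt q)\<^sup>2))"
        using s q by (simp add: power_divide field_simps power2_eq_square)
      finally show ?thesis using s q by simp
    qed
    have "std_normal_density y * (gauss_ratio \<rho> x y)\<^sup>2 =
        normal_density (\<rho> * x) s y * normal_density (\<rho> * x) s y / std_normal_density y"
      using normal_density_pos[of 1 0 y] by (simp add: gauss_ratio_def s_def power2_eq_square)
    also have "\<dots> = (1 / sqrt (2 * pi * s\<^sup>2) * (1 / sqrt (2 * pi * s\<^sup>2)) / (1 / sqrt (2 * pi))) *
        exp (- (y - \<rho> * x)\<^sup>2 / (2 * s\<^sup>2) + - (y - \<rho> * x)\<^sup>2 / (2 * s\<^sup>2) - - y\<^sup>2 / 2)"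
      unfolding normal_density_def exp_add exp_diff by simp
    also have "1 / sqrt (2 * pi * s\<^sup>2) * (1 / sqrt (2 * pi * s\<^sup>2)) / (1 / sqrt (2 * pi)) =
        1 / (s * sqrt q) * (1 / sqrt (2 * pi * (s / sqrt q)\<^sup>2))"
      using s q by (simp add: real_sqrt_mult real_sqrt_divide power_divide field_simps)
    finally show ?thesis
      unfolding expo exp_add c_def normal_density_def by simp
  qed
  have "integrable lborel (\<lambda>y. std_normal_density y * (gauss_ratio \<rho> x y)\<^sup>2)"
    and "(\<integral>y. std_normal_density y * (gauss_ratio \<rho> x y)\<^sup>2 \<partial>lborel) = c"
    using s q by (simp_all add: eq)
  then show ?I ?E
    by (simp_all add: integral_N01 c_def s_def q_def)
qed

text \<open>
  The second half of the computation of the squared Hilbert--Schmidt norm of the kernel: together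
  with the integral over \<open>y\<close> in \<open>gauss_ratio_L2\<close> it yields the total \<open>1 / (1 - \<rho>\<^sup>2)\<close>.
\<close>

lemma integral_exp_N01:
  assumes \<rho>: "\<bar>\<rho>\<bar> < 1"
  shows "integrable N01 (\<lambda>x. exp (\<rho>\<^sup>2 * x\<^sup>2 / (1 + \<rho>\<^sup>2)))" (is ?I)
    and "(\<integral>x. exp (\<rho>\<^sup>2 * x\<^sup>2 / (1 + \<rho>\<^sup>2)) \<partial>N01) = sqrt (1 + \<rho>\<^sup>2) / sqrt (1 - \<rho>\<^sup>2)" (is ?E)
proof -
  define s where "s = sqrt (1 - \<rho>\<^sup>2)"
  define q where "q = 1 + \<rho>\<^sup>2"
  have s: "s > 0" using \<rho> by (simp add: s_def abs_square_less_1)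
  have s2: "s\<^sup>2 = 1 - \<rho>\<^sup>2" using \<rho> by (simp add: s_def abs_square_less_1 less_imp_le)
  have q: "q > 0" by (simp add: q_def add_pos_nonneg)
  have eq: "std_normal_density x * exp (\<rho>\<^sup>2 * x\<^sup>2 / q) = sqrt q / s * normal_density 0 (sqrt q / s) x" for x
  proof -
    have "\<rho>\<^sup>2 * x\<^sup>2 / q + - (x - 0)\<^sup>2 / (2 * 1\<^sup>2) = - (x - 0)\<^sup>2 / (2 * (sqrt q / s)\<^sup>2)"
    proof -
      have "2 * q * (\<rho>\<^sup>2 * x\<^sup>2 / q + - (x - 0)\<^sup>2 / (2 * 1\<^sup>2)) = (2 * \<rho>\<^sup>2 - q) * x\<^sup>2"
        using q by (simp add: field_simps)
      also have "\<dots> = 2 * q * (- (x - 0)\<^sup>2 / (2 * (sqrt q / s)\<^sup>2))"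
        using q s by (simp add: power_divide s2) (simp add: q_def algebra_simps)
      finally show ?thesis
        by (rule mult_left_cancel[of "2 * q", THEN iffD1, rotated]) (use q in simp)
    qed
    then show ?thesis
      using s q unfolding normal_density_def
      by (simp add: exp_add[symmetric] real_sqrt_mult real_sqrt_divide power_divide) 
  qed
  have "integrable lborel (\<lambda>x. std_normal_density x * exp (\<rho>\<^sup>2 * x\<^sup>2 / q))"
    and "(\<integral>x. std_normal_density x * exp (\<rho>\<^sup>2 * x\<^sup>2 / q) \<partial>lborel) = sqrt q / s"
    using s q by (simp_all add: eq)
  then show ?I ?E
    by (simp_all add: integral_N01 s_def q_def)
qed

text \<open>
  Because \<open>f\<close> has mean zero, the kernel may be replaced by the kernel minus 1, whose squared
  Hilbert--Schmidt norm is \<open>1 / (1 - \<rho>\<^sup>2) - 1 = \<rho>\<^sup>2 / (1 - \<rho>\<^sup>2)\<close>. The Cauchy--Schwarz inequality is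
  applied once in each variable.
\<close>

lemma gauss_affine_covariance_bound:
  fixes f :: "real \<Rightarrow> real"
  assumes \<rho>: "\<bar>\<rho>\<bar> < 1" and [measurable]: "f \<in> borel_measurable borel"
    and bound: "\<And>x. \<bar>f x\<bar> \<le> c" and mean: "(\<integral>x. f x \<partial>N01) = 0"
  shows "\<bar>\<integral>x. f x * (\<integral>z. f (\<rho> * x + sqrt (1 - \<rho>\<^sup>2) * z) \<partial>N01) \<partial>N01\<bar>
    \<le> \<bar>\<rho>\<bar> / sqrt (1 - \<rho>\<^sup>2) * (\<integral>x. (f x)\<^sup>2 \<partial>N01)"
proof -
  define s where "s = sqrt (1 - \<rho>\<^sup>2)"
  define q where "q = 1 + \<rho>\<^sup>2"
  define V where "V = (\<integral>x. (f x)\<^sup>2 \<partial>N01)"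
  define G where "G x = (\<integral>z. f (\<rho> * x + s * z) \<partial>N01)" for x
  define e where "e x = exp (\<rho>\<^sup>2 * x\<^sup>2 / q) / (s * sqrt q)" for x
  have s: "s > 0" using \<rho> by (simp add: s_def abs_square_less_1)
  have s2: "s\<^sup>2 = 1 - \<rho>\<^sup>2" using \<rho> by (simp add: s_def abs_square_less_1 less_imp_le)
  have q: "q > 0" by (simp add: q_def add_pos_nonneg)
  interpret N: prob_space N01 by (rule prob_space_normal_density) simp
  have f1: "integrable N01 f" and f2: "integrable N01 (\<lambda>x. (f x)\<^sup>2)"
    using N.integrable_if_bounded[of f c] bound by simp_all
  have V: "V \<ge> 0" by (simp add: V_def)
  have [measurable]: "G \<in> borel_measurable borel"
    unfolding G_def by measurable
  have G_bound: "\<bar>G x\<bar> \<le> c" for x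
  proof -
    have "norm (G x) \<le> (\<integral>z. c \<partial>N01)"
      unfolding G_def
      by (rule Bochner_Integration.integral_norm_bound_integral)
        (use bound in \<open>auto intro!: N.integrable_if_bounded(1)[of _ c]\<close>)
    then show ?thesis by (simp add: measure_N01_UNIV)
  qed
  have G2: "integrable N01 (\<lambda>x. (G x)\<^sup>2)"
    using N.integrable_if_bounded(2)[of G c] G_bound by simp
  \<comment> \<open>Cauchy--Schwarz in \<open>y\<close> for fixed \<open>x\<close>, after subtracting the mean of \<open>f\<close>\<close>
  have G_le: "(G x)\<^sup>2 \<le> V * (e x - 1)" for x
  proof -
    let ?r = "gauss_ratio \<rho> x"
    have r2: "integrable N01 (\<lambda>y. (?r y)\<^sup>2)"
      by (rule gauss_ratio_L2[OF \<rho>])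
    have r1: "integrable N01 ?r" and rf: "integrable N01 (\<lambda>y. ?r y * f y)"
      using Cauchy_Schwarz_integral(1)[OF _ _ r2, of "\<lambda>_. 1"] Cauchy_Schwarz_integral(1)[OF _ _ r2 f2]
      by simp_all
    have "(\<integral>y. ?r y \<partial>N01) = 1"
      using gauss_ratio_affine[OF \<rho>, of "\<lambda>_. 1" x] by (simp add: measure_N01_UNIV)
    then have sq: "(\<integral>y. (?r y - 1)\<^sup>2 \<partial>N01) = e x - 1"
      using r1 r2 gauss_ratio_L2(2)[OF \<rho>, of x]
      by (simp add: power2_diff e_def s_def q_def measure_N01_UNIV)
    have "G x = (\<integral>y. ?r y * f y \<partial>N01) - (\<integral>y. f y \<partial>N01)"
      using gauss_ratio_affine[OF \<rho>, of f x] by (simp add: G_def s_def mean)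
    also have "\<dots> = (\<integral>y. f y * (?r y - 1) \<partial>N01)"
      using rf f1 by (simp add: algebra_simps)
    finally have G_eq: "G x = (\<integral>y. f y * (?r y - 1) \<partial>N01)" .
    have "integrable N01 (\<lambda>y. (?r y - 1)\<^sup>2)"
      using r1 r2 by (simp add: power2_diff)
    then have "(G x)\<^sup>2 \<le> V * (\<integral>y. (?r y - 1)\<^sup>2 \<partial>N01)"
      unfolding V_def G_eq by (intro Cauchy_Schwarz_integral(2) f2) simp_all
    then show ?thesis by (simp add: sq)
  qed
  have e_int: "integrable N01 e" and e_val: "(\<integral>x. e x \<partial>N01) = 1 / s\<^sup>2"
    using integral_exp_N01[OF \<rho>] s q
    by (simp_all add: e_def[abs_def] q_def s_def power2_eq_square)
  have "(\<integral>x. (G x)\<^sup>2 \<partial>N01) \<le> (\<integral>x. V * (e x - 1) \<partial>N01)"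
    using e_int by (intro integral_mono G2 G_le) simp
  also have "\<dots> = V * (1 / s\<^sup>2 - 1)"
    using e_int by (simp add: e_val measure_N01_UNIV)
  also have "1 / s\<^sup>2 - 1 = (\<bar>\<rho>\<bar> / s)\<^sup>2"
  proof -
    have "\<rho>\<^sup>2 = 1 - s\<^sup>2" by (simp add: s2)
    then show ?thesis using s by (simp add: power_divide diff_divide_distrib)
  qed
  finally have G_L2: "(\<integral>x. (G x)\<^sup>2 \<partial>N01) \<le> V * (\<bar>\<rho>\<bar> / s)\<^sup>2" .
  have "(\<integral>x. f x * G x \<partial>N01)\<^sup>2 \<le> V * (\<integral>x. (G x)\<^sup>2 \<partial>N01)"
    unfolding V_def by (rule Cauchy_Schwarz_integral(2)) (use f2 G2 in auto)
  also have "\<dots> \<le> V * (V * (\<bar>\<rho>\<bar> / s)\<^sup>2)"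
    by (intro mult_left_mono G_L2 V)
  also have "\<dots> = (\<bar>\<rho>\<bar> / s * V)\<^sup>2"
    by (simp add: power2_eq_square)
  finally have "\<bar>\<integral>x. f x * G x \<partial>N01\<bar> \<le> \<bar>\<bar>\<rho>\<bar> / s * V\<bar>"
    by (simp only: abs_le_square_iff)
  moreover have "0 \<le> \<bar>\<rho>\<bar> / s * V"
    using V s by simp
  ultimately have "\<bar>\<integral>x. f x * G x \<partial>N01\<bar> \<le> \<bar>\<rho>\<bar> / s * V"
    by linarith
  then show ?thesis by (simp add: G_def V_def s_def)
qed

section \<open>Gaussian vectors\<close>

text \<open>
  Treats the degenerate case \<open>\<sigma> = 0\<close> together with the others, so that moments and characteristic
  function of any normal law come from those of the standard one.
\<close>

lemma normal_distr_eq_distr_N01: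
  assumes "0 \<le> \<sigma>"
  shows "normal_distr \<mu> \<sigma> = distr N01 borel (\<lambda>z. \<mu> + \<sigma> * z)"
proof -
  interpret N: prob_space N01 by (rule prob_space_normal_density) simp
  show ?thesis
  proof (cases "\<sigma> = 0")
    case True
    have "emeasure (return borel \<mu>) A = emeasure (distr N01 borel (\<lambda>z. \<mu>)) A" if [measurable]: "A \<in> sets borel" for A
      using N.emeasure_space_1 by (simp add: emeasure_distr indicator_def vimage_def)
    then show ?thesis
      unfolding True normal_distr_def by (intro measure_eqI) auto
  next
    case False
    then have \<sigma>: "\<sigma> > 0" using assms by simp
    have "distributed N01 lborel (\<lambda>z. z) std_normal_density"
      by (auto simp: distributed_def distr_id2)
    from N.normal_density_affine[OF this, of \<sigma> \<mu>] \<sigma>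
    have "distributed N01 lborel (\<lambda>z. \<mu> + \<sigma> * z) (normal_density \<mu> \<sigma>)"
      by simp
    from distributed_distr_eq_density[OF this]
    have "distr N01 lborel (\<lambda>z. \<mu> + \<sigma> * z) = density lborel (normal_density \<mu> \<sigma>)" .
    moreover have "distr N01 lborel (\<lambda>z. \<mu> + \<sigma> * z) = distr N01 borel (\<lambda>z. \<mu> + \<sigma> * z)"
      by (rule distr_cong) auto
    ultimately show ?thesis
      using \<sigma> by (simp add: normal_distr_def)
  qed
qed

lemma N01_moments:
  "integrable N01 (\<lambda>x. x)" "(\<integral>x. x \<partial>N01) = 0"
  "integrable N01 (\<lambda>x. x\<^sup>2)" "(\<integral>x. x\<^sup>2 \<partial>N01) = 1"
  using integrable_std_normal_moment[of 1] integral_std_normal_moment_odd[of 0]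
    integrable_std_normal_moment[of 2] integral_std_normal_moment_even[of 1]
  by (simp_all add: integral_N01 fact_2)

lemma (in prob_space) gaussian_moments:
  fixes W :: "'a \<Rightarrow> real"
  assumes [measurable]: "W \<in> borel_measurable M"
    and \<sigma>: "0 \<le> \<sigma>" and W: "distr M borel W = normal_distr \<mu> \<sigma>"
  shows "expectation W = \<mu>"
    and "expectation (\<lambda>\<omega>. (W \<omega>)\<^sup>2) = \<mu>\<^sup>2 + \<sigma>\<^sup>2"
    and "expectation (\<lambda>\<omega>. iexp (W \<omega>)) = iexp \<mu> * complex_of_real (exp (- \<sigma>\<^sup>2 / 2))"
proof -
  interpret N: prob_space N01 by (rule prob_space_normal_density) simp
  have law: "distr M borel W = distr N01 borel (\<lambda>z. \<mu> + \<sigma> * z)"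
    unfolding W by (rule normal_distr_eq_distr_N01[OF \<sigma>])
  have transfer: "(\<integral>\<omega>. g (W \<omega>) \<partial>M) = (\<integral>z. g (\<mu> + \<sigma> * z) \<partial>N01)"
    if [measurable]: "g \<in> borel_measurable borel"
    for g :: "real \<Rightarrow> 'b :: {banach, second_countable_topology}"
    using arg_cong[OF law, of "\<lambda>L. integral\<^sup>L L g"] by (simp add: integral_distr)
  have sq: "(\<mu> + \<sigma> * z)\<^sup>2 = \<mu>\<^sup>2 + 2 * \<mu> * \<sigma> * z + \<sigma>\<^sup>2 * z\<^sup>2" for z
    by (simp add: power2_eq_square algebra_simps)
  have int_const: "integrable N01 (\<lambda>_. r)" for r :: real
    by (rule N.integrable_const)
  have int_lin: "integrable N01 (\<lambda>z. r * z)" and int_quad: "integrable N01 (\<lambda>z. r * z\<^sup>2)" for r :: real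
    by (intro integrable_mult_right N01_moments)+
  have "(\<integral>z. \<mu> + \<sigma> * z \<partial>N01) = \<mu>"
    by (subst Bochner_Integration.integral_add[OF int_const int_lin]) (simp add: N01_moments measure_N01_UNIV)
  then show "expectation W = \<mu>"
    using transfer[of "\<lambda>x. x"] by simp
  have "(\<integral>z. (\<mu> + \<sigma> * z)\<^sup>2 \<partial>N01) = \<mu>\<^sup>2 + \<sigma>\<^sup>2"
    unfolding sq
    by (subst Bochner_Integration.integral_add[OF Bochner_Integration.integrable_add[OF int_const int_lin] int_quad],
        subst Bochner_Integration.integral_add[OF int_const int_lin])
      (simp add: N01_moments measure_N01_UNIV)
  then show "expectation (\<lambda>\<omega>. (W \<omega>)\<^sup>2) = \<mu>\<^sup>2 + \<sigma>\<^sup>2"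
    using transfer[of "\<lambda>x. x\<^sup>2"] by simp
  have "expectation (\<lambda>\<omega>. iexp (W \<omega>)) = (\<integral>z. iexp \<mu> * iexp (\<sigma> * z) \<partial>N01)"
    using transfer[of "\<lambda>x. iexp x"] by (simp add: exp_add algebra_simps)
  also have "\<dots> = iexp \<mu> * char N01 \<sigma>"
    unfolding char_def by (rule integral_mult_right_zero)
  finally show "expectation (\<lambda>\<omega>. iexp (W \<omega>)) = iexp \<mu> * complex_of_real (exp (- \<sigma>\<^sup>2 / 2))"
    by (simp add: char_std_normal_distribution)
qed

lemma (in prob_space) centered_gaussian_iexp:
  fixes W :: "'a \<Rightarrow> real"
  assumes "W \<in> borel_measurable M"
    and W: "\<exists>\<mu> \<sigma>. 0 \<le> \<sigma> \<and> distr M borel W = normal_distr \<mu> \<sigma>"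
    and "expectation W = 0" "expectation (\<lambda>\<omega>. (W \<omega>)\<^sup>2) = v"
  shows "expectation (\<lambda>\<omega>. iexp (W \<omega>)) = complex_of_real (exp (- v / 2))"
proof -
  obtain \<mu> \<sigma> where "0 \<le> \<sigma>" "distr M borel W = normal_distr \<mu> \<sigma>"
    using W by blast
  from gaussian_moments[OF assms(1) this] assms(3,4) show ?thesis by simp
qed

lemma (in prob_space) distr_eq_N01I:
  fixes W :: "'a \<Rightarrow> real"
  assumes [measurable]: "W \<in> borel_measurable M"
    and char: "\<And>t. expectation (\<lambda>\<omega>. iexp (t * W \<omega>)) = complex_of_real (exp (- t\<^sup>2 / 2))"
  shows "distr M borel W = N01"
proof (rule Levy_uniqueness)
  show "char (distr M borel W) = char N01"
    using char by (simp add: char_std_normal_distribution fun_eq_iff) (simp add: char_def integral_distr)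
qed (simp_all add: real_distribution_distr real_dist_normal_dist)

lemma (in prob_space) bivariate_normal_iexp:
  fixes X Y :: "'a \<Rightarrow> real"
  assumes [measurable]: "X \<in> borel_measurable M" "Y \<in> borel_measurable M"
    and gauss: "\<And>a b. \<exists>\<mu> \<sigma>. 0 \<le> \<sigma> \<and> distr M borel (\<lambda>\<omega>. a * X \<omega> + b * Y \<omega>) = normal_distr \<mu> \<sigma>"
    and mean: "expectation X = 0" "expectation Y = 0"
    and var: "expectation (\<lambda>\<omega>. (X \<omega>)\<^sup>2) = 1" "expectation (\<lambda>\<omega>. (Y \<omega>)\<^sup>2) = 1"
    and cov: "expectation (\<lambda>\<omega>. X \<omega> * Y \<omega>) = \<rho>"
  shows "expectation (\<lambda>\<omega>. iexp (a * X \<omega> + b * Y \<omega>)) = complex_of_real (exp (- (a\<^sup>2 + 2 * a * b * \<rho> + b\<^sup>2) / 2))"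
proof (rule centered_gaussian_iexp[OF _ gauss])
  \<comment> \<open>A non-integrable function has the integral 0, so the value 1 forces integrability.\<close>
  have X2: "integrable M (\<lambda>\<omega>. (X \<omega>)\<^sup>2)" and Y2: "integrable M (\<lambda>\<omega>. (Y \<omega>)\<^sup>2)"
    using var not_integrable_integral_eq[of M "\<lambda>\<omega>. (X \<omega>)\<^sup>2"] not_integrable_integral_eq[of M "\<lambda>\<omega>. (Y \<omega>)\<^sup>2"]
    by fastforce+
  have int: "integrable M X" "integrable M Y" and XY: "integrable M (\<lambda>\<omega>. X \<omega> * Y \<omega>)"
    using Cauchy_Schwarz_integral(1)[OF _ _ X2, of "\<lambda>_. 1"] Cauchy_Schwarz_integral(1)[OF _ _ Y2, of "\<lambda>_. 1"]
      Cauchy_Schwarz_integral(1)[OF _ _ X2 Y2] by simp_all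
  show "expectation (\<lambda>\<omega>. a * X \<omega> + b * Y \<omega>) = 0"
    using int mean by simp
  have "(a * X \<omega> + b * Y \<omega>)\<^sup>2 = a\<^sup>2 * (X \<omega>)\<^sup>2 + 2 * a * b * (X \<omega> * Y \<omega>) + b\<^sup>2 * (Y \<omega>)\<^sup>2" for \<omega>
    by (simp add: power2_eq_square algebra_simps)
  then show "expectation (\<lambda>\<omega>. (a * X \<omega> + b * Y \<omega>)\<^sup>2) = a\<^sup>2 + 2 * a * b * \<rho> + b\<^sup>2"
    using X2 Y2 XY by (simp add: var cov)
qed simp

text \<open>
  For \<open>\<bar>\<rho>\<bar> > 1/2\<close> the bound follows from the Cauchy--Schwarz inequality. For \<open>\<bar>\<rho>\<bar> \<le> 1/2\<close> the
  normalised residual \<open>Z\<close> of \<open>Y\<close> given \<open>X\<close> is standard normal and independent of \<open>X\<close>, so that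
  \<open>gauss_affine_covariance_bound\<close> applies; the factor 2 dominates \<open>1 / sqrt (1 - \<rho>\<^sup>2)\<close>.
\<close>

lemma (in prob_space) bivariate_normal_covariance_bound:
  fixes X Y :: "'a \<Rightarrow> real"
  assumes XY_meas[measurable]: "X \<in> borel_measurable M" "Y \<in> borel_measurable M"
    and gauss: "\<And>a b. \<exists>\<mu> \<sigma>. 0 \<le> \<sigma> \<and> distr M borel (\<lambda>\<omega>. a * X \<omega> + b * Y \<omega>) = normal_distr \<mu> \<sigma>"
    and mean: "expectation X = 0" "expectation Y = 0"
    and var: "expectation (\<lambda>\<omega>. (X \<omega>)\<^sup>2) = 1" "expectation (\<lambda>\<omega>. (Y \<omega>)\<^sup>2) = 1"
    and cov: "expectation (\<lambda>\<omega>. X \<omega> * Y \<omega>) = \<rho>"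
    and f[measurable]: "f \<in> borel_measurable borel" and bound: "\<And>x. \<bar>f x\<bar> \<le> c"
    and f0: "(\<integral>x. f x \<partial>N01) = 0"
  shows "\<bar>expectation (\<lambda>\<omega>. f (X \<omega>) * f (Y \<omega>))\<bar> \<le> 2 * \<bar>\<rho>\<bar> * (\<integral>x. (f x)\<^sup>2 \<partial>N01)"
proof -
  note iexp_eq = bivariate_normal_iexp[OF XY_meas gauss mean var cov]
  define V where "V = (\<integral>x. (f x)\<^sup>2 \<partial>N01)"
  have V: "V \<ge> 0" by (simp add: V_def)
  have lawX: "distr M borel X = N01"
    using iexp_eq[of _ 0] by (intro distr_eq_N01I) simp_all
  have lawY: "distr M borel Y = N01"
    using iexp_eq[of 0] by (intro distr_eq_N01I) simp_all
  interpret N: prob_space N01 by (rule prob_space_normal_density) simp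
  have V_X: "expectation (\<lambda>\<omega>. (f (X \<omega>))\<^sup>2) = V" and V_Y: "expectation (\<lambda>\<omega>. (f (Y \<omega>))\<^sup>2) = V"
    using arg_cong[OF lawX, of "\<lambda>L. \<integral>x. (f x)\<^sup>2 \<partial>L"] arg_cong[OF lawY, of "\<lambda>L. \<integral>x. (f x)\<^sup>2 \<partial>L"]
    by (simp_all add: V_def integral_distr)
  show ?thesis
  proof (cases "\<bar>\<rho>\<bar> \<le> 1 / 2")
    case False
    have "(expectation (\<lambda>\<omega>. f (X \<omega>) * f (Y \<omega>)))\<^sup>2 \<le> V * V"
      using Cauchy_Schwarz_integral(2)[of "\<lambda>\<omega>. f (X \<omega>)" M "\<lambda>\<omega>. f (Y \<omega>)"]
        integrable_if_bounded(2)[of "\<lambda>\<omega>. f (X \<omega>)" c] integrable_if_bounded(2)[of "\<lambda>\<omega>. f (Y \<omega>)" c]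
      by (simp add: bound V_X V_Y)
    then have "\<bar>expectation (\<lambda>\<omega>. f (X \<omega>) * f (Y \<omega>))\<bar> \<le> V"
      using V abs_le_square_iff[of _ V] by (simp add: power2_eq_square)
    also have "\<dots> \<le> 2 * \<bar>\<rho>\<bar> * V"
      using False V mult_right_mono[of 1 "2 * \<bar>\<rho>\<bar>" V] by simp
    finally show ?thesis by (simp add: V_def)
  next
    case True
    define s where "s = sqrt (1 - \<rho>\<^sup>2)"
    have \<rho>2: "\<rho>\<^sup>2 \<le> 1 / 4"
      using power_mono[OF True, of 2] by (simp add: power2_eq_square)
    have s: "s \<ge> 1 / 2"
      unfolding s_def by (rule real_le_rsqrt) (use \<rho>2 in \<open>simp add: power2_eq_square\<close>)
    have s2: "s\<^sup>2 = 1 - \<rho>\<^sup>2" using \<rho>2 by (simp add: s_def)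
    define Z where "Z \<omega> = (Y \<omega> - \<rho> * X \<omega>) / s" for \<omega>
    have [measurable]: "Z \<in> borel_measurable M" unfolding Z_def by measurable
    have Y_eq: "Y \<omega> = \<rho> * X \<omega> + s * Z \<omega>" for \<omega>
      using s by (simp add: Z_def)
    \<comment> \<open>\<open>u * X + t * Z\<close> is a combination of \<open>X\<close> and \<open>Y\<close> whose variance is \<open>u\<^sup>2 + t\<^sup>2\<close>.\<close>
    have iexp_Z: "expectation (\<lambda>\<omega>. iexp (u * X \<omega> + t * Z \<omega>)) = complex_of_real (exp (- (u\<^sup>2 + t\<^sup>2) / 2))" for u t
    proof -
      let ?a = "u - t * \<rho> / s" and ?b = "t / s"
      have lin: "u * X \<omega> + t * Z \<omega> = ?a * X \<omega> + ?b * Y \<omega>" for \<omega>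
        using s by (simp add: Z_def field_simps)
      have "s\<^sup>2 * (?a\<^sup>2 + 2 * ?a * ?b * \<rho> + ?b\<^sup>2) = (s * ?a)\<^sup>2 + 2 * (s * ?a) * (s * ?b) * \<rho> + (s * ?b)\<^sup>2"
        by (simp add: power2_eq_square algebra_simps)
      also have "s * ?a = s * u - t * \<rho>" using s by (simp add: field_simps)
      also have "s * ?b = t" using s by simp
      also have "(s * u - t * \<rho>)\<^sup>2 + 2 * (s * u - t * \<rho>) * t * \<rho> + t\<^sup>2 = s\<^sup>2 * u\<^sup>2 + (1 - \<rho>\<^sup>2) * t\<^sup>2"
        by (simp add: power2_eq_square algebra_simps)
      also have "\<dots> = s\<^sup>2 * (u\<^sup>2 + t\<^sup>2)"
        unfolding s2[symmetric] by (simp add: algebra_simps)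
      finally have "?a\<^sup>2 + 2 * ?a * ?b * \<rho> + ?b\<^sup>2 = u\<^sup>2 + t\<^sup>2"
        using s by simp
      then show ?thesis
        unfolding lin iexp_eq by simp
    qed
    have lawZ: "distr M borel Z = N01"
      using iexp_Z[of 0] by (intro distr_eq_N01I) simp_all
    have "indep_var borel X borel Z"
    proof (rule indep_var_if_iexp_factors)
      fix u t :: real
      have "complex_of_real (exp (- (u\<^sup>2 + t\<^sup>2) / 2)) =
          complex_of_real (exp (- (u\<^sup>2 + 0\<^sup>2) / 2)) * complex_of_real (exp (- (0\<^sup>2 + t\<^sup>2) / 2))"
        by (simp add: diff_divide_distrib flip: exp_add of_real_mult)
      then show "expectation (\<lambda>\<omega>. iexp (u * X \<omega> + t * Z \<omega>)) =
          expectation (\<lambda>\<omega>. iexp (u * X \<omega>)) * expectation (\<lambda>\<omega>. iexp (t * Z \<omega>))"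
        using iexp_Z[of u t] iexp_Z[of u 0] iexp_Z[of 0 t] by simp
    qed simp_all
    then have joint: "distr M (borel \<Otimes>\<^sub>M borel) (\<lambda>\<omega>. (X \<omega>, Z \<omega>)) = N01 \<Otimes>\<^sub>M N01"
      by (simp add: indep_var_distribution_eq lawX lawZ)
    interpret NN: pair_prob_space N01 N01 ..
    have "expectation (\<lambda>\<omega>. f (X \<omega>) * f (Y \<omega>)) =
        expectation (\<lambda>\<omega>. (\<lambda>(x, z). f x * f (\<rho> * x + s * z)) (X \<omega>, Z \<omega>))"
      by (simp add: Y_eq)
    also have "\<dots> = (\<integral>p. (\<lambda>(x, z). f x * f (\<rho> * x + s * z)) p \<partial>distr M (borel \<Otimes>\<^sub>M borel) (\<lambda>\<omega>. (X \<omega>, Z \<omega>)))"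
      by (rule integral_distr[symmetric]) measurable
    also have "\<dots> = (\<integral>x. (\<integral>z. f x * f (\<rho> * x + s * z) \<partial>N01) \<partial>N01)"
      unfolding joint
    proof (rule NN.integral_fst[symmetric])
      show "integrable (N01 \<Otimes>\<^sub>M N01) (\<lambda>(x, z). f x * f (\<rho> * x + s * z))"
        using mult_mono[OF bound bound] order_trans[OF abs_ge_zero bound]
        by (intro NN.integrable_const_bound[of _ "c * c"]) (auto simp: abs_mult intro!: AE_I2)
    qed
    also have "\<dots> = (\<integral>x. f x * (\<integral>z. f (\<rho> * x + s * z) \<partial>N01) \<partial>N01)"
      by simp
    also have "\<bar>\<dots>\<bar> \<le> \<bar>\<rho>\<bar> / s * V"
      unfolding s_def V_def
      by (rule gauss_affine_covariance_bound[OF _ f bound f0]) (use True in simp)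
    also have "\<dots> \<le> 2 * \<bar>\<rho>\<bar> * V"
      using s V divide_left_mono[of "1 / 2" s "\<bar>\<rho>\<bar>"] by (intro mult_right_mono) (simp_all add: mult.commute)
    finally show ?thesis by (simp add: V_def)
  qed
qed

lemma multivariate_normal_covariance_bound:
  fixes X :: "'i \<Rightarrow> 'a \<Rightarrow> real"
  assumes "prob_space M" and "finite I"
    and normal: "multivariate_normal M I X (\<lambda>_. 0) C"
    and ij: "i \<in> I" "j \<in> I" and unit: "C i i = 1" "C j j = 1"
    and f: "f \<in> borel_measurable borel" "\<And>x. \<bar>f x\<bar> \<le> c" "(\<integral>x. f x \<partial>N01) = 0"
  shows "\<bar>\<integral>\<omega>. f (X i \<omega>) * f (X j \<omega>) \<partial>M\<bar> \<le> 2 * \<bar>C i j\<bar> * (\<integral>x. (f x)\<^sup>2 \<partial>N01)"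
proof -
  interpret prob_space M by fact
  have moments: "X k \<in> borel_measurable M" "expectation (X k) = 0" if "k \<in> I" for k
    using normal that by (auto simp: multivariate_normal_def jointly_gaussian_def)
  have cov: "expectation (\<lambda>\<omega>. X k \<omega> * X m \<omega>) = C k m" if "k \<in> I" "m \<in> I" for k m
    using normal that by (auto simp: multivariate_normal_def)
  show ?thesis
  proof (rule bivariate_normal_covariance_bound)
    \<comment> \<open>The weights are added, so that they are also right for \<open>i = j\<close>.\<close>
    fix a b :: real
    let ?w = "\<lambda>k. (if k = i then a else 0) + (if k = j then b else 0)"
    have "\<exists>\<mu> \<sigma>. 0 \<le> \<sigma> \<and> distr M borel (\<lambda>\<omega>. \<Sum>k\<in>I. ?w k * X k \<omega>) = normal_distr \<mu> \<sigma>"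
      using normal unfolding multivariate_normal_def jointly_gaussian_def
      by (elim conjE) (erule spec)
    moreover have "(\<Sum>k\<in>I. ?w k * X k \<omega>) = a * X i \<omega> + b * X j \<omega>" for \<omega>
      using ij \<open>finite I\<close> by (simp add: distrib_right sum.distrib if_distrib[of "\<lambda>r. r * _"] cong: if_cong)
    ultimately show "\<exists>\<mu> \<sigma>. 0 \<le> \<sigma> \<and> distr M borel (\<lambda>\<omega>. a * X i \<omega> + b * X j \<omega>) = normal_distr \<mu> \<sigma>"
      by simp
  qed (use moments cov ij unit f in \<open>auto simp: power2_eq_square\<close>)
qed

lemma multivariate_normal_marginal:
  fixes X :: "'i \<Rightarrow> 'a \<Rightarrow> real"
  assumes "prob_space M" and "finite I"
    and normal: "multivariate_normal M I X (\<lambda>_. 0) C"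
    and i: "i \<in> I" and unit: "C i i = 1"
  shows "X i \<in> borel_measurable M" "distr M borel (X i) = N01"
proof -
  interpret prob_space M by fact
  show meas: "X i \<in> borel_measurable M"
    using normal i by (auto simp: multivariate_normal_def jointly_gaussian_def)
  let ?w = "\<lambda>k. if k = i then 1 else 0 :: real"
  have "\<exists>\<mu> \<sigma>. 0 \<le> \<sigma> \<and> distr M borel (\<lambda>\<omega>. \<Sum>k\<in>I. ?w k * X k \<omega>) = normal_distr \<mu> \<sigma>"
    using normal unfolding multivariate_normal_def jointly_gaussian_def
    by (elim conjE) (erule spec)
  moreover have "(\<Sum>k\<in>I. ?w k * X k \<omega>) = X i \<omega>" for \<omega>
    using i \<open>finite I\<close> by (simp add: if_distrib[of "\<lambda>r. r * _"] cong: if_cong)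
  ultimately obtain \<mu> \<sigma> where \<sigma>: "0 \<le> \<sigma>" and law: "distr M borel (X i) = normal_distr \<mu> \<sigma>"
    by auto
  have "expectation (X i) = 0" "expectation (\<lambda>\<omega>. (X i \<omega>)\<^sup>2) = 1"
    using normal i unit by (auto simp: multivariate_normal_def power2_eq_square)
  with gaussian_moments(1,2)[OF meas \<sigma> law] have "\<mu> = 0" "\<sigma>\<^sup>2 = 1"
    by simp_all
  with \<sigma> have "\<sigma> = 1" by (simp add: power2_eq_1_iff)
  with law \<open>\<mu> = 0\<close> show "distr M borel (X i) = N01"
    by (simp add: normal_distr_def)
qed

section \<open>The probability integral transform\<close>

lemma Phi_measurable[measurable]: "Phi \<in> borel_measurable borel"
proof -
  interpret N: cdf_distribution N01
    unfolding cdf_distribution_def by (rule real_dist_normal_dist)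
  show ?thesis unfolding Phi_def by (rule N.measurable_C)
qed

lemma Phi_bounds: "0 \<le> Phi x" "Phi x \<le> 1"
proof -
  interpret N: real_distribution N01 by (rule real_dist_normal_dist)
  show "0 \<le> Phi x" "Phi x \<le> 1"
    unfolding Phi_def by (rule N.cdf_nonneg, rule N.cdf_bounded_prob)
qed

text \<open>
  The standard normal law is the image of the uniform law on \<open>(0,1)\<close> under the generalised inverse
  \<open>I\<close> of \<open>Phi\<close>. The law has no atoms, so \<open>Phi\<close> is continuous and \<open>Phi (I y) = y\<close>.
\<close>

lemma integral_Phi_N01:
  fixes h :: "real \<Rightarrow> real"
  assumes [measurable]: "h \<in> borel_measurable borel"
  shows "(\<integral>x. h (Phi x) \<partial>N01) = (LINT y:{0..1}|lborel. h y)"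
proof -
  interpret N: cdf_distribution N01
    unfolding cdf_distribution_def by (rule real_dist_normal_dist)
  define I where "I y = Inf {x. y \<le> Phi x}" for y
  have [measurable]: "I \<in> borel_measurable (restrict_space borel {0<..<1})"
    unfolding I_def[abs_def] Phi_def by (rule N.measurable_CI)
  have law: "distr (restrict_space lborel {0<..<1}) borel I = N01"
    unfolding I_def[abs_def] Phi_def by (rule N.distr_I_eq_M)
  have cont: "isCont Phi x" for x
  proof -
    have "AE y in lborel. y \<noteq> x"
      by (rule AE_lborel_singleton)
    then have "emeasure N01 {x} = 0"
      by (subst emeasure_density) (auto intro!: nn_integral_0_iff_AE[THEN iffD2] split: split_indicator)
    then show ?thesis
      unfolding Phi_def N.isCont_cdf by (simp add: measure_def)
  qed
  have Phi_I: "Phi (I y) = y" if y: "0 < y" "y < 1" for y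
  proof (rule antisym)
    have inv: "y \<le> Phi x \<longleftrightarrow> I y \<le> x" for x
      unfolding I_def Phi_def using N.pseudoinverse[OF y] .
    show "y \<le> Phi (I y)" using inv by simp
    have "(Phi \<longlongrightarrow> Phi (I y)) (at_left (I y))"
      using cont[of "I y"] by (simp add: isCont_def filterlim_at_split)
    moreover have "eventually (\<lambda>x. Phi x \<le> y) (at_left (I y))"
      using inv by (auto simp: eventually_at_filter not_le intro!: always_eventually) (metis linorder_not_le less_imp_le)
    ultimately show "Phi (I y) \<le> y"
      by (rule tendsto_upperbound) simp
  qed
  have "(\<integral>x. h (Phi x) \<partial>N01) = (\<integral>y. h (Phi (I y)) \<partial>restrict_space lborel {0<..<1})"
    unfolding law[symmetric] by (rule integral_distr) (simp_all cong: measurable_cong_sets)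
  also have "\<dots> = (\<integral>y. h y \<partial>restrict_space lborel {0<..<1})"
    by (intro Bochner_Integration.integral_cong refl) (simp add: space_restrict_space Phi_I)
  also have "\<dots> = (LINT y:{0<..<1}|lborel. h y)"
    unfolding set_lebesgue_integral_def by (rule integral_restrict_space) simp
  also have "\<dots> = (LINT y:{0..1}|lborel. h y)"
    unfolding set_lebesgue_integral_def
  proof (rule integral_cong_AE)
    show "AE y in lborel. indicator {0<..<1} y *\<^sub>R h y = indicator {0..1} y *\<^sub>R h y"
      using AE_lborel_singleton[of 0] AE_lborel_singleton[of 1]
      by eventually_elim (auto simp: indicator_def)
  qed simp_all
  finally show ?thesis .
qed

lemma expectation_Phi:
  fixes h :: "real \<Rightarrow> real"
  assumes [measurable]: "X \<in> borel_measurable M" "h \<in> borel_measurable borel"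
    and law: "distr M borel X = N01"
  shows "(\<integral>\<omega>. h (Phi (X \<omega>)) \<partial>M) = (LINT y:{0..1}|lborel. h y)"
  using arg_cong[OF law, of "\<lambda>L. \<integral>x. h (Phi x) \<partial>L"] by (simp add: integral_distr integral_Phi_N01)

definition uniform_variance :: "(real \<Rightarrow> real) \<Rightarrow> real" where
  "uniform_variance h = (LINT y:{0..1}|lborel. (h y)\<^sup>2) - (LINT y:{0..1}|lborel. h y)\<^sup>2"

text \<open>
  Centring \<open>h \<circ> Phi\<close> provides the mean-zero function to which the covariance bound is applied.
\<close>

lemma uniform_variance_N01:
  fixes h :: "real \<Rightarrow> real"
  assumes [measurable]: "h \<in> borel_measurable borel" and bound: "\<And>y. \<bar>h y\<bar> \<le> c"
  defines "f \<equiv> \<lambda>x. h (Phi x) - (LINT y:{0..1}|lborel. h y)"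
  shows "(\<integral>x. f x \<partial>N01) = 0" and "(\<integral>x. (f x)\<^sup>2 \<partial>N01) = uniform_variance h"
proof -
  interpret N: prob_space N01 by (rule prob_space_normal_density) simp
  have int: "integrable N01 (\<lambda>x. h (Phi x))" "integrable N01 (\<lambda>x. (h (Phi x))\<^sup>2)"
    by (rule N.integrable_if_bounded[of _ c]; use bound in simp)+
  have mean: "(\<integral>x. h (Phi x) \<partial>N01) = (LINT y:{0..1}|lborel. h y)"
    by (rule integral_Phi_N01) simp
  show "(\<integral>x. f x \<partial>N01) = 0"
    using int by (simp add: f_def mean measure_N01_UNIV)
  show "(\<integral>x. (f x)\<^sup>2 \<partial>N01) = uniform_variance h"
    using N.variance_eq[OF int] integral_Phi_N01[of "\<lambda>y. (h y)\<^sup>2"]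
    by (simp add: f_def mean uniform_variance_def)
qed

lemma uniform_variance_bounds:
  fixes h :: "real \<Rightarrow> real"
  assumes [measurable]: "h \<in> borel_measurable borel" and bound: "\<And>y. \<bar>h y\<bar> \<le> c"
  shows "0 \<le> uniform_variance h" "uniform_variance h \<le> c\<^sup>2"
proof -
  interpret N: prob_space N01 by (rule prob_space_normal_density) simp
  show "0 \<le> uniform_variance h"
    by (subst uniform_variance_N01(2)[of h c, symmetric]) (simp_all add: bound)
  have le: "(h y)\<^sup>2 \<le> c\<^sup>2" for y
    using power_mono[OF bound[of y] abs_ge_zero, where n = 2] by simp
  have "uniform_variance h \<le> (\<integral>x. (h (Phi x))\<^sup>2 \<partial>N01)"
    using integral_Phi_N01[of "\<lambda>y. (h y)\<^sup>2"] by (simp add: uniform_variance_def)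
  also have "\<dots> \<le> (\<integral>x. c\<^sup>2 \<partial>N01)"
    using N.integrable_if_bounded(2)[of "\<lambda>x. h (Phi x)" c] bound le by (intro integral_mono) simp_all
  finally show "uniform_variance h \<le> c\<^sup>2" by (simp add: measure_N01_UNIV)
qed

section \<open>Variance of the averaged derivative\<close>

text \<open>
  The variance of a sum is the sum of all covariances. The diagonal terms obey the same bound
  \<open>2 \<bar>C i j\<bar> V\<close> as the others because \<open>C i i = 1\<close>, and summing \<open>\<bar>C i j\<bar>\<close> over all pairs gives
  \<open>n + \<Delta>\<close>.
\<close>

lemma (in prob_space) variance_average_le:
  fixes X :: "nat \<Rightarrow> 'a \<Rightarrow> real" and h :: "real \<Rightarrow> real"
  assumes "n \<ge> 1" and normal: "multivariate_normal M {1..n} X (\<lambda>_. 0) C"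
    and unit: "\<forall>i\<in>{1..n}. C i i = 1"
    and [measurable]: "h \<in> borel_measurable borel" and bound: "\<And>y. \<bar>h y\<bar> \<le> c"
  shows "variance (\<lambda>\<omega>. (\<Sum>i\<in>{1..n}. h (Phi (X i \<omega>))) / real n) \<le>
     2 * ((real n + (\<Sum>i\<in>{1..n}. \<Sum>j\<in>{1..n} - {i}. \<bar>C i j\<bar>)) / (real n)\<^sup>2) * uniform_variance h"
proof -
  define m where "m = (LINT y:{0..1}|lborel. h y)"
  define f where "f x = h (Phi x) - m" for x
  define V where "V = uniform_variance h"
  have n: "real n > 0" using \<open>n \<ge> 1\<close> by simp
  have X_meas[measurable]: "X i \<in> borel_measurable M" and law: "distr M borel (X i) = N01" if "i \<in> {1..n}" for i
    using multivariate_normal_marginal[OF prob_space_axioms _ normal that] unit that by auto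
  have [measurable]: "f \<in> borel_measurable borel" unfolding f_def by measurable
  have f_bound: "\<bar>f x\<bar> \<le> c + \<bar>m\<bar>" for x
    using bound[of "Phi x"] by (simp add: f_def)
  have f0: "(\<integral>x. f x \<partial>N01) = 0" and f2: "(\<integral>x. (f x)\<^sup>2 \<partial>N01) = V"
    using uniform_variance_N01[of h c] bound by (simp_all add: f_def[abs_def] m_def V_def)
  have mean: "expectation (\<lambda>\<omega>. (\<Sum>i\<in>{1..n}. h (Phi (X i \<omega>))) / real n) = m"
  proof -
    have "expectation (\<lambda>\<omega>. \<Sum>i\<in>{1..n}. h (Phi (X i \<omega>))) = (\<Sum>i\<in>{1..n}. expectation (\<lambda>\<omega>. h (Phi (X i \<omega>))))"
      using bound by (intro Bochner_Integration.integral_sum integrable_if_bounded(1)[of _ c]) simp_all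
    also have "\<dots> = (\<Sum>i\<in>{1..n}. m)"
      unfolding m_def by (intro sum.cong refl expectation_Phi law) simp_all
    finally show ?thesis using n by simp
  qed
  have ff_int: "integrable M (\<lambda>\<omega>. f (X i \<omega>) * f (X j \<omega>))" if "i \<in> {1..n}" "j \<in> {1..n}" for i j
    using that f_bound by (intro Cauchy_Schwarz_integral(1) integrable_if_bounded(2)[of _ "c + \<bar>m\<bar>"]) simp_all
  have "variance (\<lambda>\<omega>. (\<Sum>i\<in>{1..n}. h (Phi (X i \<omega>))) / real n) =
      expectation (\<lambda>\<omega>. ((\<Sum>i\<in>{1..n}. f (X i \<omega>)) / real n)\<^sup>2)"
    unfolding mean using n by (simp add: f_def sum_subtractf diff_divide_distrib)
  also have "\<dots> = expectation (\<lambda>\<omega>. (\<Sum>i\<in>{1..n}. \<Sum>j\<in>{1..n}. f (X i \<omega>) * f (X j \<omega>)) / (real n)\<^sup>2)"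
    by (simp add: power2_eq_square sum_product)
  also have "\<dots> = (\<Sum>i\<in>{1..n}. \<Sum>j\<in>{1..n}. expectation (\<lambda>\<omega>. f (X i \<omega>) * f (X j \<omega>))) / (real n)\<^sup>2"
  proof -
    have "expectation (\<lambda>\<omega>. \<Sum>i\<in>{1..n}. \<Sum>j\<in>{1..n}. f (X i \<omega>) * f (X j \<omega>)) =
        (\<Sum>i\<in>{1..n}. expectation (\<lambda>\<omega>. \<Sum>j\<in>{1..n}. f (X i \<omega>) * f (X j \<omega>)))"
      by (intro Bochner_Integration.integral_sum Bochner_Integration.integrable_sum ff_int)
    also have "\<dots> = (\<Sum>i\<in>{1..n}. \<Sum>j\<in>{1..n}. expectation (\<lambda>\<omega>. f (X i \<omega>) * f (X j \<omega>)))"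
      by (intro sum.cong refl Bochner_Integration.integral_sum ff_int)
    finally show ?thesis by simp
  qed
  also have "\<dots> \<le> (\<Sum>i\<in>{1..n}. \<Sum>j\<in>{1..n}. 2 * \<bar>C i j\<bar> * V) / (real n)\<^sup>2"
  proof (intro divide_right_mono sum_mono)
    fix i j assume ij: "i \<in> {1..n}" "j \<in> {1..n}"
    show "expectation (\<lambda>\<omega>. f (X i \<omega>) * f (X j \<omega>)) \<le> 2 * \<bar>C i j\<bar> * V"
      using multivariate_normal_covariance_bound[OF prob_space_axioms _ normal ij _ _ _ f_bound f0] unit ij
      by (simp add: f2)
  qed simp
  also have "(\<Sum>i\<in>{1..n}. \<Sum>j\<in>{1..n}. 2 * \<bar>C i j\<bar> * V) = 2 * (\<Sum>i\<in>{1..n}. \<Sum>j\<in>{1..n}. \<bar>C i j\<bar>) * V"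
    by (simp add: sum_distrib_left sum_distrib_right)
  also have "(\<Sum>i\<in>{1..n}. \<Sum>j\<in>{1..n}. \<bar>C i j\<bar>) = (\<Sum>i\<in>{1..n}. 1 + (\<Sum>j\<in>{1..n} - {i}. \<bar>C i j\<bar>))"
    using unit by (intro sum.cong refl) (subst sum.remove, auto)
  also have "\<dots> = real n + (\<Sum>i\<in>{1..n}. \<Sum>j\<in>{1..n} - {i}. \<bar>C i j\<bar>)"
    by (simp add: sum.distrib)
  finally show ?thesis by (simp add: V_def)
qed

section \<open>From the supremum to standard deviations\<close>

text \<open>
  A process of the form \<open>t \<mapsto> q + \<integral>s. k t s * A s\<close> with kernels bounded by 1 deviates from its mean
  by at most \<open>\<integral>s. \<bar>A s - E (A s)\<bar>\<close>, whatever \<open>t\<close> is. This majorant is measurable, so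
  Fubini's theorem applies to it although the supremum ranges over an arbitrary index type.
\<close>

lemma (in prob_space) expectation_sup_integral_le:
  fixes A :: "'b \<Rightarrow> 'a \<Rightarrow> real" and k :: "'c \<Rightarrow> 'b \<Rightarrow> real"
  assumes "finite_measure T"
    and A[measurable]: "case_prod A \<in> borel_measurable (T \<Otimes>\<^sub>M M)"
    and A_bound: "\<And>s \<omega>. \<bar>A s \<omega>\<bar> \<le> c"
    and k[measurable]: "\<And>t. k t \<in> borel_measurable T" and k_bound: "\<And>t s. \<bar>k t s\<bar> \<le> 1"
    and Q: "\<And>t \<omega>. \<omega> \<in> space M \<Longrightarrow> Q t \<omega> = q + (\<integral>s. k t s * A s \<omega> \<partial>T)"
  shows "(\<integral>\<^sup>+ \<omega>. (SUP t. ennreal \<bar>Q t \<omega> - expectation (Q t)\<bar>) \<partial>M)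
    \<le> ennreal (\<integral>s. sqrt (variance (A s)) \<partial>T)"
proof -
  interpret T: finite_measure T by fact
  interpret TM: pair_sigma_finite T M ..
  interpret P: finite_measure "T \<Otimes>\<^sub>M M"
    by (rule finite_measure_pair_measure) unfold_locales
  have int_T: "integrable T g" if "g \<in> borel_measurable T" "\<And>s. \<bar>g s\<bar> \<le> r" for g and r :: real
    using that by (intro T.integrable_const_bound[of _ r]) simp_all
  have int_P: "integrable (T \<Otimes>\<^sub>M M) g" if "g \<in> borel_measurable (T \<Otimes>\<^sub>M M)" "\<And>p. \<bar>g p\<bar> \<le> r" for g and r :: real
    using that by (intro P.integrable_const_bound[of _ r]) simp_all
  have A_meas[measurable]: "A s \<in> borel_measurable M" if "s \<in> space T" for s
    using measurable_compose[OF measurable_Pair1'[OF that] A] by simp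
  define a where "a s = expectation (A s)" for s
  have [measurable]: "a \<in> borel_measurable T"
    unfolding a_def by measurable
  have c: "0 \<le> c" using A_bound[of undefined undefined] by linarith
  have a_bound: "\<bar>a s\<bar> \<le> c" for s
  proof (cases "integrable M (A s)")
    case True
    have "\<bar>a s\<bar> \<le> expectation (\<lambda>\<omega>. \<bar>A s \<omega>\<bar>)"
      unfolding a_def by (rule integral_abs_bound)
    also have "\<dots> \<le> expectation (\<lambda>_. c)"
      using True A_bound by (intro integral_mono) auto
    finally show ?thesis by (simp add: prob_space)
  next
    case False
    then show ?thesis using c by (simp add: a_def not_integrable_integral_eq)
  qed
  define B where "B s \<omega> = A s \<omega> - a s" for s \<omega>
  have B_meas[measurable]: "case_prod B \<in> borel_measurable (T \<Otimes>\<^sub>M M)"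
    unfolding B_def by measurable
  have B_bound: "\<bar>B s \<omega>\<bar> \<le> 2 * c" for s \<omega>
    using A_bound[of s \<omega>] a_bound[of s] by (simp add: B_def)
  have kA_bound: "\<bar>k t s * A s \<omega>\<bar> \<le> c" for t s \<omega>
    using mult_mono[OF k_bound[of t s] A_bound[of s \<omega>]] c by (simp add: abs_mult)
  have ka_bound: "\<bar>k t s * a s\<bar> \<le> c" for t s
    using mult_mono[OF k_bound[of t s] a_bound[of s]] c by (simp add: abs_mult)
  have EQ: "expectation (Q t) = q + (\<integral>s. k t s * a s \<partial>T)" for t
  proof -
    have P_int: "integrable (T \<Otimes>\<^sub>M M) (\<lambda>(s, \<omega>). k t s * A s \<omega>)"
      by (rule int_P[of _ c]) (use kA_bound in auto)
    have "expectation (Q t) = (\<integral>\<omega>. q + (\<integral>s. k t s * A s \<omega> \<partial>T) \<partial>M)"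
      by (rule Bochner_Integration.integral_cong) (simp_all add: Q)
    also have "\<dots> = q + (\<integral>\<omega>. (\<integral>s. k t s * A s \<omega> \<partial>T) \<partial>M)"
      using TM.integrable_snd[OF P_int] by (simp add: prob_space)
    also have "(\<integral>\<omega>. (\<integral>s. k t s * A s \<omega> \<partial>T) \<partial>M) = (\<integral>s. (\<integral>\<omega>. k t s * A s \<omega> \<partial>M) \<partial>T)"
      by (rule TM.Fubini_integral[OF P_int])
    finally show ?thesis by (simp add: a_def)
  qed
  define J where "J \<omega> = (\<integral>s. \<bar>B s \<omega>\<bar> \<partial>T)" for \<omega>
  have Q_dev: "\<bar>Q t \<omega> - expectation (Q t)\<bar> \<le> J \<omega>" if \<omega>[measurable]: "\<omega> \<in> space M" for t \<omega>
  proof -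
    have [measurable]: "(\<lambda>s. A s \<omega>) \<in> borel_measurable T"
      using measurable_compose[OF measurable_Pair2'[OF \<omega>] A] by simp
    have "Q t \<omega> - expectation (Q t) = (\<integral>s. k t s * A s \<omega> \<partial>T) - (\<integral>s. k t s * a s \<partial>T)"
      by (simp add: Q[OF \<omega>] EQ)
    also have "\<dots> = (\<integral>s. k t s * A s \<omega> - k t s * a s \<partial>T)"
      by (intro Bochner_Integration.integral_diff[symmetric] int_T[of _ c] kA_bound ka_bound) measurable
    also have "\<dots> = (\<integral>s. k t s * B s \<omega> \<partial>T)"
      by (simp add: B_def right_diff_distrib)
    also have "\<bar>\<dots>\<bar> \<le> J \<omega>"
    proof -
      have [measurable]: "(\<lambda>s. B s \<omega>) \<in> borel_measurable T"
        unfolding B_def by measurable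
      have le: "\<bar>k t s * B s \<omega>\<bar> \<le> \<bar>B s \<omega>\<bar>" for s
        using mult_right_mono[OF k_bound[of t s], of "\<bar>B s \<omega>\<bar>"] by (simp add: abs_mult)
      have int_kB: "integrable T (\<lambda>s. k t s * B s \<omega>)" and int_B: "integrable T (\<lambda>s. B s \<omega>)"
        using B_bound order_trans[OF le B_bound] by (auto intro!: int_T[of _ "2 * c"])
      have "\<bar>\<integral>s. k t s * B s \<omega> \<partial>T\<bar> \<le> (\<integral>s. \<bar>k t s * B s \<omega>\<bar> \<partial>T)"
        by (rule integral_abs_bound)
      also have "\<dots> \<le> J \<omega>"
        unfolding J_def by (intro integral_mono le integrable_abs int_kB int_B)
      finally show ?thesis .
    qed
    finally show ?thesis .
  qed
  have absB_int: "integrable (T \<Otimes>\<^sub>M M) (\<lambda>(s, \<omega>). \<bar>B s \<omega>\<bar>)"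
    by (rule int_P[of _ "2 * c"]) (use B_bound in auto)
  have "(\<integral>\<^sup>+ \<omega>. (SUP t. ennreal \<bar>Q t \<omega> - expectation (Q t)\<bar>) \<partial>M) \<le> (\<integral>\<^sup>+ \<omega>. ennreal (J \<omega>) \<partial>M)"
    by (intro nn_integral_mono SUP_least ennreal_leI Q_dev)
  also have "\<dots> = ennreal (expectation J)"
    using TM.integrable_snd[OF absB_int] unfolding J_def
    by (intro nn_integral_eq_integral) auto
  also have "expectation J = (\<integral>s. (\<integral>\<omega>. \<bar>B s \<omega>\<bar> \<partial>M) \<partial>T)"
    unfolding J_def by (rule TM.Fubini_integral[OF absB_int])
  also have "\<dots> \<le> (\<integral>s. sqrt (variance (A s)) \<partial>T)"
  proof (rule integral_mono)
    show "integrable T (\<lambda>s. expectation (\<lambda>\<omega>. \<bar>B s \<omega>\<bar>))"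
      using TM.integrable_fst[OF absB_int] .
    have var_bound: "variance (A s) \<le> (2 * c)\<^sup>2" if "s \<in> space T" for s
    proof -
      have [measurable]: "B s \<in> borel_measurable M" unfolding B_def using that by measurable
      have sq_le: "(B s \<omega>)\<^sup>2 \<le> (2 * c)\<^sup>2" for \<omega>
        using power_mono[OF B_bound[of s \<omega>] abs_ge_zero, where n = 2] by simp
      have "expectation (\<lambda>\<omega>. (B s \<omega>)\<^sup>2) \<le> expectation (\<lambda>_. (2 * c)\<^sup>2)"
        using integrable_if_bounded(2)[of "B s" "2 * c"] B_bound sq_le
        by (intro integral_mono) auto
      then show ?thesis by (simp add: B_def a_def prob_space)
    qed
    have "(\<lambda>s. variance (A s)) \<in> borel_measurable T"
      unfolding a_def[symmetric] by measurable
    then show "integrable T (\<lambda>s. sqrt (variance (A s)))"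
      using c var_bound
      by (intro T.integrable_const_bound[of _ "2 * c"] AE_I2) (auto intro!: real_le_lsqrt)
    fix s assume s: "s \<in> space T"
    have [measurable]: "B s \<in> borel_measurable M" unfolding B_def using s by measurable
    show "expectation (\<lambda>\<omega>. \<bar>B s \<omega>\<bar>) \<le> sqrt (variance (A s))"
      using expectation_abs_le_sqrt[of "B s"] integrable_if_bounded(2)[of "B s" "2 * c"] B_bound
      by (simp add: B_def a_def)
  qed
  finally show ?thesis by (simp add: ennreal_leI)
qed

text \<open>
  In the third part \<open>t\<close> ranges over all reals while the integration stays on \<open>[-1,2]\<close>. For
  \<open>0 \<le> y \<le> 1\<close> the interval \<open>(-\<infinity>,-1/2)\<close> contains \<open>-1 - y\<close>, and \<open>(1/2,\<infinity>)\<close> contains \<open>2 - y\<close>;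
  on both of them \<open>l\<close> is constant because \<open>l'\<close> vanishes there.
\<close>

lemma primitive_of_bump:
  fixes l :: "real \<Rightarrow> real"
  assumes C1: "l C1_differentiable_on UNIV"
    and supp: "closure {x. deriv l x \<noteq> 0} \<subseteq> {-1/2..1/2}"
  shows "continuous_on UNIV (deriv l)"
    and "\<exists>c. \<forall>x. \<bar>deriv l x\<bar> \<le> c"
    and "0 \<le> y \<Longrightarrow> y \<le> 1 \<Longrightarrow>
      l (t - y) = l (-1) + (\<integral>s. indicator {..t} s * deriv l (s - y) \<partial>restrict_space lborel {-1..2})"
proof -
  obtain d where d: "\<And>x. (l has_vector_derivative d x) (at x)" and cont: "continuous_on UNIV d"
    using C1 unfolding C1_differentiable_on_def by blast
  have der: "(l has_real_derivative d x) (at x)" for x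
    using d by (simp add: has_real_derivative_iff_has_vector_derivative)
  have deriv_eq: "deriv l = d"
    using der by (auto intro: DERIV_imp_deriv)
  show "continuous_on UNIV (deriv l)"
    using cont by (simp add: deriv_eq)
  have zero: "d x = 0" if "x \<notin> {-1/2..1/2}" for x
    using that supp closure_subset[of "{x. d x \<noteq> 0}"] unfolding deriv_eq by blast
  show "\<exists>c. \<forall>x. \<bar>deriv l x\<bar> \<le> c"
  proof -
    have "bounded (d ` {-1/2..1/2})"
      by (intro compact_imp_bounded compact_continuous_image continuous_on_subset[OF cont]) auto
    then obtain c where c: "\<And>x. x \<in> {-1/2..1/2} \<Longrightarrow> \<bar>d x\<bar> \<le> c"
      unfolding bounded_iff by (metis imageI real_norm_def)
    have "\<bar>d x\<bar> \<le> \<bar>c\<bar>" for x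
      using c[of x] zero[of x] by (cases "x \<in> {-1/2..1/2}") auto
    then show ?thesis unfolding deriv_eq by blast
  qed
  have const: "l x = l x'" if "convex S" "\<And>x. x \<in> S \<Longrightarrow> d x = 0" "x \<in> S" "x' \<in> S" for S x x'
  proof -
    have "(l has_real_derivative 0) (at x within S)" if "x \<in> S" for x
      using has_field_derivative_at_within[OF der[of x], of S] \<open>x \<in> S\<close> \<open>\<And>x. x \<in> S \<Longrightarrow> d x = 0\<close> by simp
    then obtain b where "\<And>x. x \<in> S \<Longrightarrow> l x = b"
      using has_field_derivative_zero_constant[OF \<open>convex S\<close>] by blast
    then show ?thesis using that by simp
  qed
  have left: "l x = l x'" if "x < -1/2" "x' < -1/2" for x x'
    by (rule const[of "{..<-1/2}"]) (use that zero in auto)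
  have right: "l x = l x'" if "1/2 < x" "1/2 < x'" for x x'
    by (rule const[of "{1/2<..}"]) (use that zero in auto)
  assume y: "0 \<le> y" "y \<le> 1"
  have FTC: "(\<integral>s. indicator {-1..b} s *\<^sub>R d (s - y) \<partial>lborel) = l (b - y) - l (-1)" if "-1 \<le> b" for b
  proof -
    have "(\<integral>s. indicator {-1..b} s *\<^sub>R d (s - y) \<partial>lborel) = l (b - y) - l (-1 - y)"
    proof (rule integral_FTC_atLeastAtMost[OF that])
      fix s
      have "((\<lambda>s. s - y) has_real_derivative 1) (at s within {-1..b})"
        by (auto intro!: derivative_eq_intros)
      from DERIV_chain2[of l "d (s - y)" "\<lambda>s. s - y", OF der this]
      have "((\<lambda>s. l (s - y)) has_real_derivative d (s - y)) (at s within {-1..b})"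
        by simp
      then show "((\<lambda>s. l (s - y)) has_vector_derivative d (s - y)) (at s within {-1..b})"
        by (simp add: has_real_derivative_iff_has_vector_derivative)
    next
      show "continuous_on {-1..b} (\<lambda>s. d (s - y))"
        by (intro continuous_on_compose2[OF cont] continuous_intros) auto
    qed
    also have "l (-1 - y) = l (-1)"
      by (rule left) (use y in auto)
    finally show ?thesis .
  qed
  have "(\<integral>s. indicator {..t} s * deriv l (s - y) \<partial>restrict_space lborel {-1..2}) =
      (\<integral>s. indicator {-1..2} s *\<^sub>R (indicator {..t} s * d (s - y)) \<partial>lborel)"
    unfolding deriv_eq by (rule integral_restrict_space) simp
  also have "\<dots> = (\<integral>s. indicator {-1..min t 2} s *\<^sub>R d (s - y) \<partial>lborel)"
    by (intro Bochner_Integration.integral_cong) (auto simp: indicator_def)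
  also have "\<dots> = l (t - y) - l (-1)"
  proof (cases "t < -1")
    case True
    then show ?thesis using left[of "t - y" "-1"] y by simp
  next
    case False
    moreover have "l (min t 2 - y) = l (t - y)"
      using right[of "2 - y" "t - y"] y by (cases "t \<le> 2") (auto simp: min_def)
    ultimately show ?thesis using FTC[of "min t 2"] by simp
  qed
  finally show "l (t - y) = l (-1) +
      (\<integral>s. indicator {..t} s * deriv l (s - y) \<partial>restrict_space lborel {-1..2})"
    by simp
qed

theorem lemma2:
  fixes n :: nat
    and M :: "'a measure"
    and X :: "nat \<Rightarrow> 'a \<Rightarrow> real"
    and C :: "nat \<Rightarrow> nat \<Rightarrow> real"
    and l :: "real \<Rightarrow> real"
  assumes "n \<ge> 1"
    and "prob_space M"
    and "multivariate_normal M {1..n} X (\<lambda>_. 0) C"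
    and "\<forall>i\<in>{1..n}. C i i = 1"
    and "l C1_differentiable_on UNIV"
    and "closure {x. deriv l x \<noteq> 0} \<subseteq> {-1/2..1/2}"
  shows "(\<integral>\<^sup>+ \<omega>. (SUP t. ennreal \<bar>Q_hat l n X t \<omega> - (\<integral>\<omega>'. Q_hat l n X t \<omega>' \<partial>M)\<bar>) \<partial>M)
    \<le> ennreal ((sqrt 6 + sqrt 3) * D l *
        sqrt ((real n + (\<Sum>i\<in>{1..n}. \<Sum>j\<in>{1..n} - {i}. \<bar>C i j\<bar>)) / (real n)\<^sup>2))"
proof -
  interpret prob_space M by fact
  note normal = assms(3) and unit = assms(4)
  define R where "R = (real n + (\<Sum>i\<in>{1..n}. \<Sum>j\<in>{1..n} - {i}. \<bar>C i j\<bar>)) / (real n)\<^sup>2"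
  define T where "T = restrict_space lborel {-1..2 :: real}"
  define d where "d = deriv l"
  define V where "V s = uniform_variance (\<lambda>y. d (s - y))" for s
  define A where "A s \<omega> = (\<Sum>i\<in>{1..n}. d (s - Phi (X i \<omega>))) / real n" for s \<omega>
  have n: "real n > 0" using \<open>n \<ge> 1\<close> by simp
  have R: "R \<ge> 0" unfolding R_def by (intro divide_nonneg_nonneg add_nonneg_nonneg sum_nonneg) auto
  obtain c where d_bound: "\<And>x. \<bar>d x\<bar> \<le> c"
    using primitive_of_bump(2)[OF assms(5,6)] unfolding d_def by blast
  have [measurable]: "d \<in> borel_measurable borel"
    unfolding d_def by (intro borel_measurable_continuous_onI primitive_of_bump(1)[OF assms(5,6)])
  have X_meas[measurable]: "X i \<in> borel_measurable M" if "i \<in> {1..n}" for i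
    using multivariate_normal_marginal[OF \<open>prob_space M\<close> _ normal that] unit that by auto
  have emT: "emeasure T (space T) = 3"
    by (simp add: T_def emeasure_restrict_space space_restrict_space)
  interpret T: finite_measure T
    by standard (simp add: emT)
  have mT: "measure T (space T) = 3"
    by (simp add: measure_def emT)
  have [measurable]: "(\<lambda>s. s) \<in> borel_measurable T"
    unfolding T_def by (intro measurable_restrict_space1) simp
  have int_T: "integrable T g" if "g \<in> borel_measurable T" "\<And>s. \<bar>g s\<bar> \<le> r" for g and r :: real
    using that by (intro T.integrable_const_bound[of _ r]) simp_all
  have Q_eq: "Q_hat l n X t \<omega> = l (-1) + (\<integral>s. indicator {..t} s * A s \<omega> \<partial>T)" for t \<omega>
  proof -
    have int: "integrable T (\<lambda>s. indicator {..t} s * d (s - u))" for u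
      using d_bound order_trans[OF abs_ge_zero d_bound]
      by (intro int_T[of _ c]) (auto simp: indicator_def)
    have "Q_hat l n X t \<omega> = (\<Sum>i\<in>{1..n}. l (-1) + (\<integral>s. indicator {..t} s * d (s - Phi (X i \<omega>)) \<partial>T)) / real n"
      unfolding Q_hat_def T_def d_def
      by (subst primitive_of_bump(3)[OF assms(5,6) Phi_bounds]) simp
    also have "\<dots> = l (-1) + (\<Sum>i\<in>{1..n}. \<integral>s. indicator {..t} s * d (s - Phi (X i \<omega>)) \<partial>T) / real n"
      using n by (simp add: sum.distrib add_divide_distrib)
    also have "(\<Sum>i\<in>{1..n}. \<integral>s. indicator {..t} s * d (s - Phi (X i \<omega>)) \<partial>T) =
        (\<integral>s. (\<Sum>i\<in>{1..n}. indicator {..t} s * d (s - Phi (X i \<omega>))) \<partial>T)"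
      by (rule Bochner_Integration.integral_sum[symmetric]) (rule int)
    also have "\<dots> / real n = (\<integral>s. indicator {..t} s * A s \<omega> \<partial>T)"
      by (simp add: A_def sum_distrib_left[symmetric] flip: integral_divide_zero)
    finally show ?thesis .
  qed
  have A_meas: "case_prod A \<in> borel_measurable (T \<Otimes>\<^sub>M M)"
    unfolding A_def by measurable
  have A_bound: "\<bar>A s \<omega>\<bar> \<le> c" for s \<omega>
  proof -
    have "\<bar>\<Sum>i\<in>{1..n}. d (s - Phi (X i \<omega>))\<bar> \<le> (\<Sum>i\<in>{1..n}. c)"
      by (rule sum_abs[THEN order_trans]) (intro sum_mono d_bound)
    then show ?thesis using n by (simp add: A_def field_simps)
  qed
  have "(\<integral>\<^sup>+ \<omega>. (SUP t. ennreal \<bar>Q_hat l n X t \<omega> - (\<integral>\<omega>'. Q_hat l n X t \<omega>' \<partial>M)\<bar>) \<partial>M)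
      \<le> ennreal (\<integral>s. sqrt (variance (A s)) \<partial>T)"
    by (rule expectation_sup_integral_le[OF T.finite_measure_axioms A_meas A_bound _ _ Q_eq])
      (auto simp: indicator_def)
  also have "\<dots> \<le> ennreal ((sqrt 6 + sqrt 3) * D l * sqrt R)"
  proof (rule ennreal_leI)
    have [measurable]: "V \<in> borel_measurable T"
      unfolding V_def uniform_variance_def set_lebesgue_integral_def by measurable
    have V_nonneg: "0 \<le> V s" and V_le: "V s \<le> c\<^sup>2" for s
      unfolding V_def by (rule uniform_variance_bounds[of _ c]; simp add: d_bound)+
    have var_le: "variance (A s) \<le> 2 * R * V s" for s
      unfolding A_def R_def V_def
      by (rule variance_average_le[OF \<open>n \<ge> 1\<close> normal unit, of "\<lambda>y. d (s - y)" c]) (simp_all add: d_bound)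
    have V_int: "integrable T V"
      using V_nonneg V_le by (intro int_T[of _ "c\<^sup>2"]) simp_all
    have sqrt_meas: "(\<lambda>s. sqrt (2 * R * V s)) \<in> borel_measurable T"
      by measurable
    have sqrt_int: "integrable T (\<lambda>s. sqrt (2 * R * V s))"
      using R V_nonneg V_le
      by (intro int_T[of _ "sqrt (2 * R * c\<^sup>2)"] sqrt_meas) (simp add: mult_left_mono)
    have D_eq: "(D l)\<^sup>2 = (\<integral>s. V s \<partial>T)" and D_nonneg: "0 \<le> D l"
    proof -
      have "D l = sqrt (LINT s:{-1..2}|lborel. V s)"
        by (simp add: D_def V_def uniform_variance_def d_def)
      also have "(LINT s:{-1..2}|lborel. V s) = (\<integral>s. V s \<partial>T)"
        unfolding T_def set_lebesgue_integral_def by (rule integral_restrict_space[symmetric]) simp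
      finally have "D l = sqrt (\<integral>s. V s \<partial>T)" .
      then show "(D l)\<^sup>2 = (\<integral>s. V s \<partial>T)" "0 \<le> D l"
        using V_nonneg by simp_all
    qed
    have "(\<integral>s. sqrt (variance (A s)) \<partial>T) \<le> (\<integral>s. sqrt (2 * R * V s) \<partial>T)"
      by (rule integral_mono'[OF sqrt_int]) (use var_le R V_nonneg in simp_all)
    also have "\<dots> \<le> sqrt 6 * D l * sqrt R"
    proof (rule power2_le_imp_le)
      have "(\<integral>s. sqrt (2 * R * V s) \<partial>T)\<^sup>2 \<le> (\<integral>s. (sqrt (2 * R * V s))\<^sup>2 \<partial>T) * (\<integral>s. 1\<^sup>2 \<partial>T)"
        using Cauchy_Schwarz_integral(2)[OF sqrt_meas, of "\<lambda>_. 1"] V_int R V_nonneg by simp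
      also have "\<dots> = 6 * R * (D l)\<^sup>2"
        using R V_nonneg by (simp add: mT D_eq)
      also have "\<dots> = (sqrt 6 * D l * sqrt R)\<^sup>2"
        using R by (simp add: power_mult_distrib)
      finally show "(\<integral>s. sqrt (2 * R * V s) \<partial>T)\<^sup>2 \<le> (sqrt 6 * D l * sqrt R)\<^sup>2" .
    qed (use R D_nonneg in simp)
    also have "\<dots> \<le> (sqrt 6 + sqrt 3) * D l * sqrt R"
      using R D_nonneg by (intro mult_right_mono) simp_all
    finally show "(\<integral>s. sqrt (variance (A s)) \<partial>T) \<le> (sqrt 6 + sqrt 3) * D l * sqrt R" .
  qed
  finally show ?thesis by (simp add: R_def)
qed

end
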